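(* Let $G$ and $H$ be non-trivial finite groups. Then the power graph $P(G\times H)$ is a cograph if and only if one of the following holds: (a) the orders of $G$ and $H$ are powers of the same prime; (b) $G$ and $H$ are cyclic groups of distinct prime orders; (c) there are primes $p$ and $q$ and an integer $m\ge 1$ such that $q^m\mid (p-1)$, one of $G$ and $H$ is a cyclic group of order $q$, and the other is (isomorphic to) the non-abelian group $$\langle a,b : a^p=1,\ b^{q^m}=1,\ b^{-1}ab=a^k\rangle,$$ where $k$ is an integer with multiplicative order $q^m$ modulo $p$.
   Context: The (undirected) power graph $P(G)$ of a finite group $G$ is the simple graph with vertex set $G$ in which two distinct vertices $u,v$ are adjacent if and only if one of $u,v$ is a power of the other. A graph is a cograph if it has no induced subgraph isomorphic to the path $P_4$ on four vertices. *)

theory Defs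
  imports
    "HOL-Algebra.Elementary_Groups"
    "HOL-Number_Theory.Pocklington"
    "Graph_Theory.Graph_Theory"
begin

text \<open>Simple undirected graphs are represented as loop-free symmetric pair digraphs.\<close>

definition power_graph :: "('a, 'm) monoid_scheme \<Rightarrow> 'a pair_pre_digraph" where
  "power_graph G =
     \<lparr> pverts = carrier G,
       parcs = {(u, v). u \<in> carrier G \<and> v \<in> carrier G \<and> u \<noteq> v \<and>
                        ((\<exists>n::nat. u = v [^]\<^bsub>G\<^esub> n) \<or> (\<exists>n::nat. v = u [^]\<^bsub>G\<^esub> n))} \<rparr>"

definition path4 :: "nat pair_pre_digraph" where
  "path4 = \<lparr> pverts = {0, 1, 2, 3},
             parcs = {(0, 1), (1, 0), (1, 2), (2, 1), (2, 3), (3, 2)} \<rparr>"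

definition cograph :: "'a pair_pre_digraph \<Rightarrow> bool" where
  "cograph X \<longleftrightarrow>
     \<not> (\<exists>Y. induced_subgraph Y (with_proj X) \<and> digraph_iso Y (with_proj path4))"


text \<open>
  Groups given by generators (all elements of \<^typ>\<open>'g\<close>) and relations.  In a word, the letter
  \<open>(x, True)\<close> stands for the generator \<open>x\<close> and \<open>(x, False)\<close> for its formal inverse; a pair
  \<open>(u, v) \<in> R\<close> is the relation \<open>u = v\<close>.
\<close>

type_synonym 'g word = "('g \<times> bool) list"

inductive word_eq :: "('g word \<times> 'g word) set \<Rightarrow> 'g word \<Rightarrow> 'g word \<Rightarrow> bool"
  for R :: "('g word \<times> 'g word) set" where
  word_eq_refl: "word_eq R u u"
| word_eq_sym: "word_eq R u v \<Longrightarrow> word_eq R v u"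
| word_eq_trans: "word_eq R u v \<Longrightarrow> word_eq R v w \<Longrightarrow> word_eq R u w"
| word_eq_append: "word_eq R u u' \<Longrightarrow> word_eq R v v' \<Longrightarrow> word_eq R (u @ v) (u' @ v')"
| word_eq_cancel: "word_eq R [(x, e), (x, \<not> e)] []"
| word_eq_rel: "(u, v) \<in> R \<Longrightarrow> word_eq R u v"

definition word_rel :: "('g word \<times> 'g word) set \<Rightarrow> ('g word \<times> 'g word) set" where
  "word_rel R = {(u, v). word_eq R u v}"

definition presented_group :: "('g word \<times> 'g word) set \<Rightarrow> 'g word set monoid" where
  "presented_group R =
     \<lparr> carrier = UNIV // word_rel R,
       monoid.mult = (\<lambda>X Y. \<Union>u\<in>X. \<Union>v\<in>Y. word_rel R `` {u @ v}),
       one = word_rel R `` {[]} \<rparr>"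

lemma equiv_word_rel: "equiv UNIV (word_rel R)"
  by (intro equivI refl_onI symI transI)
     (auto simp: word_rel_def intro: word_eq_refl word_eq_sym word_eq_trans)

lemma presented_group_mult:
  "word_rel R `` {u} \<otimes>\<^bsub>presented_group R\<^esub> word_rel R `` {v} = word_rel R `` {u @ v}"
proof -
  have "congruent2 (word_rel R) (word_rel R) (\<lambda>u v. word_rel R `` {u @ v})"
    by (intro congruent2I' equiv_class_eq[OF equiv_word_rel])
       (auto simp: word_rel_def intro: word_eq_append)
  then show ?thesis
    unfolding presented_group_def
    by (simp add: UN_equiv_class2[OF equiv_word_rel equiv_word_rel])
qed

lemma word_eq_inverse:
  "word_eq R (rev (map (\<lambda>(x, e). (x, \<not> e)) u) @ u) []"
proof (induction u)
  case Nil
  show ?case by (simp add: word_eq_refl)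
next
  case (Cons l u)
  obtain x e where l: "l = (x, e)" by (cases l)
  let ?w = "rev (map (\<lambda>(x, e). (x, \<not> e)) u)"
  have "word_eq R [(x, \<not> e), (x, \<not> \<not> e)] []" by (rule word_eq_cancel)
  then have "word_eq R [(x, \<not> e), (x, e)] []" by simp
  then have "word_eq R (?w @ ([(x, \<not> e), (x, e)] @ u)) (?w @ ([] @ u))"
    by (intro word_eq_append word_eq_refl)
  with Cons.IH show ?case
    by (auto simp: l intro: word_eq_trans)
qed

lemma group_presented_group: "group (presented_group R)"
proof (rule groupI)
  let ?P = "presented_group R"
  have class_in: "word_rel R `` {u} \<in> carrier ?P" for u
    by (simp add: presented_group_def quotientI)
  have class_ex: "\<exists>u. X = word_rel R `` {u}" if "X \<in> carrier ?P" for X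
    using that by (auto simp: presented_group_def elim: quotientE)
  have one: "\<one>\<^bsub>?P\<^esub> = word_rel R `` {[]}"
    by (simp add: presented_group_def)
  show "\<one>\<^bsub>?P\<^esub> \<in> carrier ?P"
    by (simp add: one class_in)
  show "X \<otimes>\<^bsub>?P\<^esub> Y \<in> carrier ?P" if "X \<in> carrier ?P" "Y \<in> carrier ?P" for X Y
    using class_ex[OF that(1)] class_ex[OF that(2)] class_in
    by (auto simp: presented_group_mult)
  show "X \<otimes>\<^bsub>?P\<^esub> Y \<otimes>\<^bsub>?P\<^esub> Z = X \<otimes>\<^bsub>?P\<^esub> (Y \<otimes>\<^bsub>?P\<^esub> Z)"
    if "X \<in> carrier ?P" "Y \<in> carrier ?P" "Z \<in> carrier ?P" for X Y Z
    using class_ex[OF that(1)] class_ex[OF that(2)] class_ex[OF that(3)]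
    by (auto simp: presented_group_mult)
  show "\<one>\<^bsub>?P\<^esub> \<otimes>\<^bsub>?P\<^esub> X = X" if "X \<in> carrier ?P" for X
    using class_ex[OF that] by (auto simp: one presented_group_mult)
  show "\<exists>Y\<in>carrier ?P. Y \<otimes>\<^bsub>?P\<^esub> X = \<one>\<^bsub>?P\<^esub>" if X: "X \<in> carrier ?P" for X
  proof -
    obtain u where u: "X = word_rel R `` {u}" using class_ex[OF X] by blast
    let ?Y = "word_rel R `` {rev (map (\<lambda>(x, e). (x, \<not> e)) u)}"
    have "?Y \<otimes>\<^bsub>?P\<^esub> X = \<one>\<^bsub>?P\<^esub>"
      unfolding u one presented_group_mult
      by (rule equiv_class_eq[OF equiv_word_rel]) (simp add: word_rel_def word_eq_inverse)
    with class_in show ?thesis by blast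
  qed
qed

definition gen_pow :: "'g \<Rightarrow> int \<Rightarrow> 'g word" where
  "gen_pow x n = replicate (nat \<bar>n\<bar>) (x, n \<ge> 0)"

datatype gen_ab = gen_a | gen_b

definition metacyclic_pres :: "nat \<Rightarrow> nat \<Rightarrow> int \<Rightarrow> gen_ab word set monoid" where
  "metacyclic_pres r s k = presented_group
     {(gen_pow gen_a (int r), []),
      (gen_pow gen_b (int s), []),
      (gen_pow gen_b (- 1) @ gen_pow gen_a 1 @ gen_pow gen_b 1, gen_pow gen_a k)}"

end

theory Submission
  imports Defs "HOL-Algebra.Sylow"
begin

text \<open>
  ``Being a power of'' is a preorder, so an induced path on four vertices must be a zigzag
  \<open>u < v > w < x\<close>. Here \<open>u\<close> and \<open>w\<close> are incomparable in the cyclic group \<open>\<langle>v\<rangle>\<close>, so \<open>v\<close> does not have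
  prime power order; this settles \<open>p\<close>-groups. In cases (b) and (c) the elements of mixed order all
  generate the same subgroup \<open>C\<^sub>q \<times> C\<^sub>p\<close>, which leaves no room for \<open>x\<close>.

  Conversely, let \<open>x \<in> G\<close> and \<open>y \<in> H\<close> have distinct prime orders \<open>p\<close> and \<open>q\<close>. The absence of zigzags
  \<open>(1, y) < (x, y) > (x, 1) < z\<close> forces every element of \<open>G\<close> to lie in \<open>\<langle>x\<rangle>\<close> or to have \<open>q\<close>-power
  order, and symmetrically for \<open>H\<close>. One of the factors must be \<open>\<langle>x\<rangle>\<close> or \<open>\<langle>y\<rangle>\<close>, say \<open>H = \<langle>y\<rangle>\<close>. Then
  \<open>\<langle>x\<rangle>\<close> is normal and self-centralising in \<open>G\<close>, so \<open>G / \<langle>x\<rangle>\<close> embeds into the cyclic group of units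
  mod \<open>p\<close> and \<open>G\<close> is the semidirect product of case (c), unless \<open>G = \<langle>x\<rangle>\<close>.
\<close>

section \<open>Induced paths in power graphs\<close>

definition is_power :: "('a, 'm) monoid_scheme \<Rightarrow> 'a \<Rightarrow> 'a \<Rightarrow> bool" where
  "is_power M u v \<longleftrightarrow> (\<exists>n::nat. u = v [^]\<^bsub>M\<^esub> n)"

text \<open>Adjacency in the power graph without the demand that the vertices differ. The relation
  is reflexive, so incomparable elements are automatically distinct.\<close>

definition comparable :: "('a, 'm) monoid_scheme \<Rightarrow> 'a \<Rightarrow> 'a \<Rightarrow> bool" where
  "comparable M u v \<longleftrightarrow> is_power M u v \<or> is_power M v u"

definition zigzag :: "('a, 'm) monoid_scheme \<Rightarrow> 'a \<Rightarrow> 'a \<Rightarrow> 'a \<Rightarrow> 'a \<Rightarrow> bool" where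
  "zigzag M u v w x \<longleftrightarrow> {u, v, w, x} \<subseteq> carrier M \<and>
     is_power M u v \<and> is_power M w v \<and> is_power M w x \<and>
     \<not> comparable M u w \<and> \<not> comparable M u x \<and> \<not> comparable M v x"

definition zigzag_free :: "('a, 'm) monoid_scheme \<Rightarrow> bool" where
  "zigzag_free M \<longleftrightarrow> \<not> (\<exists>u v w x. zigzag M u v w x)"

lemma (in group) is_power_trans:
  assumes "is_power G u v" "is_power G v w" "w \<in> carrier G"
  shows "is_power G u w"
  using assms by (auto simp: is_power_def nat_pow_pow)

lemma (in group) is_power_refl:
  assumes "u \<in> carrier G"
  shows "is_power G u u"
  unfolding is_power_def by (rule exI[of _ 1]) (use assms in simp)

lemma (in group) is_power_one: "is_power G \<one> u"
  unfolding is_power_def by (rule exI[of _ 0]) simp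

lemma (in group) is_power_pow: "is_power G (u [^] (n::nat)) u"
  unfolding is_power_def by blast

lemma parcs_power_graph:
  "(u, v) \<in> parcs (power_graph M) \<longleftrightarrow>
     u \<in> carrier M \<and> v \<in> carrier M \<and> u \<noteq> v \<and> comparable M u v"
  by (auto simp: power_graph_def comparable_def is_power_def)

lemma wf_power_graph: "wf_digraph (with_proj (power_graph M))"
  by unfold_locales (auto simp: with_proj_def power_graph_def)

text \<open>Two consecutive edges of an induced path cannot point the same way, by transitivity.\<close>

lemma (in group) zigzag_of_path:
  assumes "{a, b, c, d} \<subseteq> carrier G"
    and "comparable G a b" "comparable G b c" "comparable G c d"
    and "\<not> comparable G a c" "\<not> comparable G a d" "\<not> comparable G b d"
  shows "zigzag G a b c d \<or> zigzag G d c b a"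
  using assms is_power_trans unfolding zigzag_def comparable_def
  by (smt (verit) insert_subset)

text \<open>Vertices that are not consecutive differ because they are incomparable. If two
  consecutive ones coincided, a neighbouring edge would make two non-consecutive vertices
  comparable.\<close>

lemma zigzag_distinct:
  assumes "group M" and z: "zigzag M u v w x"
  shows "distinct [u, v, w, x]"
proof -
  interpret group M by fact
  show ?thesis using z is_power_refl
    unfolding zigzag_def comparable_def by auto
qed

lemma cograph_power_graph_iff:
  assumes "group M"
  shows "cograph (power_graph M) \<longleftrightarrow> zigzag_free M"
proof -
  interpret group M by fact
  let ?X = "with_proj (power_graph M)" and ?P = "with_proj path4"
  have "\<exists>u v w x. zigzag M u v w x"
    if Y: "induced_subgraph Y ?X" "digraph_iso Y ?P" for Y
  proof -
    from Y(2) obtain f where f: "pre_digraph.digraph_isomorphism Y f" "?P = app_iso f Y"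
      unfolding digraph_iso_def by blast
    let ?f = "iso_verts f"
    have sub: "verts Y \<subseteq> carrier M" and comp: "tail Y = fst" "head Y = snd"
      and arcs: "arcs Y = {e \<in> parcs (power_graph M). fst e \<in> verts Y \<and> snd e \<in> verts Y}"
      using Y(1) by (auto simp: induced_subgraph_def subgraph_def compatible_def with_proj_def
          power_graph_def)
    have inj: "inj_on ?f (verts Y)"
      and ft: "\<And>e. e \<in> arcs Y \<Longrightarrow> ?f (fst e) = iso_tail f (iso_arcs f e)"
      and fh: "\<And>e. e \<in> arcs Y \<Longrightarrow> ?f (snd e) = iso_head f (iso_arcs f e)"
      using f(1) comp by (auto simp: pre_digraph.digraph_isomorphism_def)
    have P: "pverts path4 = ?f ` verts Y" "parcs path4 = iso_arcs f ` arcs Y"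
      "iso_tail f = fst" "iso_head f = snd"
      using f(2) by (simp_all add: app_iso_def with_proj_def)
    \<comment> \<open>Arcs are pairs with \<open>fst\<close> and \<open>snd\<close> as ends on both
      sides, so the arc map is forced by the vertex map.\<close>
    have fa: "iso_arcs f (u, v) = (?f u, ?f v)" if "(u, v) \<in> arcs Y" for u v
      using ft[OF that] fh[OF that] P by (metis fst_conv prod.collapse snd_conv)
    have adj: "(?f u, ?f v) \<in> parcs path4 \<longleftrightarrow> u \<noteq> v \<and> comparable M u v"
      if "u \<in> verts Y" "v \<in> verts Y" for u v
    proof -
      have "(?f u, ?f v) \<in> parcs path4 \<longleftrightarrow> (u, v) \<in> arcs Y"
      proof
        assume "(?f u, ?f v) \<in> parcs path4"
        then obtain e where e: "e \<in> arcs Y" "iso_arcs f e = (?f u, ?f v)" using P(2) by auto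
        obtain u' v' where e': "e = (u', v')" by (cases e)
        with e fa have "?f u' = ?f u" "?f v' = ?f v" by auto
        moreover have "u' \<in> verts Y" "v' \<in> verts Y" using e(1) arcs e' by auto
        ultimately have "u' = u" "v' = v" using inj that by (auto dest: inj_onD)
        with e e' show "(u, v) \<in> arcs Y" by simp
      next
        assume "(u, v) \<in> arcs Y"
        with fa P(2) show "(?f u, ?f v) \<in> parcs path4" by (metis image_eqI)
      qed
      also have "\<dots> \<longleftrightarrow> u \<noteq> v \<and> comparable M u v"
        using that sub unfolding arcs by (auto simp: parcs_power_graph)
      finally show ?thesis .
    qed
    have "{0, 1, 2, 3} \<subseteq> ?f ` verts Y" using P(1) by (simp add: path4_def)
    then obtain a b c d where v: "a \<in> verts Y" "b \<in> verts Y" "c \<in> verts Y" "d \<in> verts Y"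
      "?f a = 0" "?f b = 1" "?f c = 2" "?f d = 3"
      by (auto simp: image_iff)
    have "comparable M a b" "comparable M b c" "comparable M c d"
      using adj[OF v(1,2)] adj[OF v(2,3)] adj[OF v(3,4)] v by (auto simp: path4_def)
    moreover have "\<not> comparable M a c" "\<not> comparable M a d" "\<not> comparable M b d"
      using adj[OF v(1,3)] adj[OF v(1,4)] adj[OF v(2,4)] v
      by (auto simp: path4_def)
    ultimately show ?thesis using zigzag_of_path[of a b c d] v sub by blast
  qed
  moreover have "\<exists>Y. induced_subgraph Y ?X \<and> digraph_iso Y ?P" if z: "zigzag M u v w x" for u v w x
  proof -
    let ?V = "{u, v, w, x}"
    have d: "distinct [u, v, w, x]" by (rule zigzag_distinct[OF assms z])
    \<comment> \<open>The witness is the subgraph on the four vertices of the zigzag; the fact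
      \<open>E\<close> below checks that no further edge is induced.\<close>
    define E where "E = {(u, v), (v, u), (v, w), (w, v), (w, x), (x, w)}"
    define Y where "Y = \<lparr>verts = ?V, arcs = E, tail = fst, head = snd\<rparr>"
    have E: "E = {e \<in> parcs (power_graph M). fst e \<in> ?V \<and> snd e \<in> ?V}"
    proof (rule Set.set_eqI)
      fix e :: "'a \<times> 'a"
      obtain s t where e: "e = (s, t)" by (cases e)
      show "e \<in> E \<longleftrightarrow> e \<in> {e \<in> parcs (power_graph M). fst e \<in> ?V \<and> snd e \<in> ?V}"
        using z d unfolding e E_def zigzag_def comparable_def
        by (auto simp: parcs_power_graph comparable_def)
    qed
    have wfY: "wf_digraph Y" by unfold_locales (auto simp: Y_def E_def)
    have "induced_subgraph Y ?X"
      unfolding induced_subgraph_def subgraph_def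
    proof (intro conjI)
      show "verts Y \<subseteq> verts ?X"
        using z by (auto simp: Y_def with_proj_def power_graph_def zigzag_def)
      show "arcs Y \<subseteq> arcs ?X" unfolding Y_def with_proj_def by (auto simp: E)
      show "compatible ?X Y" by (auto simp: compatible_def Y_def with_proj_def)
      show "arcs Y = {e \<in> arcs ?X. tail ?X e \<in> verts Y \<and> head ?X e \<in> verts Y}"
        by (simp add: Y_def with_proj_def E)
    qed (use wfY wf_power_graph in auto)
    moreover have "digraph_iso Y ?P"
    proof -
      define g :: "'a \<Rightarrow> nat" where
        "g s = (if s = u then 0 else if s = v then 1 else if s = w then 2 else 3)" for s
      have g: "g u = 0" "g v = 1" "g w = 2" "g x = 3" using d by (auto simp: g_def)
      define f where "f = \<lparr>iso_verts = g, iso_arcs = map_prod g g, iso_head = snd, iso_tail = fst\<rparr>"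
      have inj: "inj_on g ?V" using g by (auto simp: inj_on_def)
      have "inj_on (map_prod g g) (?V \<times> ?V)" by (intro map_prod_inj_on inj)
      moreover have "E \<subseteq> ?V \<times> ?V" by (auto simp: E_def)
      ultimately have "inj_on (map_prod g g) E" by (rule inj_on_subset)
      then have "pre_digraph.digraph_isomorphism Y f"
        unfolding pre_digraph.digraph_isomorphism_def using wfY inj by (auto simp: Y_def f_def)
      moreover have "?P = app_iso f Y"
        by (auto simp: app_iso_def Y_def f_def with_proj_def path4_def E_def g)
      ultimately show ?thesis unfolding digraph_iso_def by blast
    qed
    ultimately show ?thesis by blast
  qed
  ultimately show ?thesis unfolding cograph_def zigzag_free_def by blast
qed

section \<open>Powers under isomorphisms and in direct products\<close>

lemma hom_nat_pow:
  assumes "group M" "group N" "f \<in> hom M N" "u \<in> carrier M"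
  shows "f (u [^]\<^bsub>M\<^esub> (n::nat)) = f u [^]\<^bsub>N\<^esub> n"
proof -
  interpret group_hom M N f using assms by (simp add: group_hom_def group_hom_axioms_def)
  show ?thesis using assms by (simp add: hom_nat_pow)
qed

lemma is_power_iso:
  assumes "group M" "group N" "f \<in> iso M N" "u \<in> carrier M" "v \<in> carrier M"
  shows "is_power N (f u) (f v) \<longleftrightarrow> is_power M u v"
proof -
  interpret group M by fact
  have h: "f \<in> hom M N" and inj: "inj_on f (carrier M)"
    using assms(3) by (auto simp: iso_def bij_betw_def)
  show ?thesis
    unfolding is_power_def hom_nat_pow[OF assms(1,2) h assms(5), symmetric]
    using inj assms(4,5) by (auto simp: inj_on_eq_iff)
qed

lemma zigzag_free_iso:
  assumes "group M" "group N" "M \<cong> N" "zigzag_free N"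
  shows "zigzag_free M"
proof -
  obtain f where f: "f \<in> iso M N" using assms(3) by (auto simp: is_iso_def)
  then have c: "\<And>u. u \<in> carrier M \<Longrightarrow> f u \<in> carrier N" by (auto simp: iso_def bij_betw_def)
  have "zigzag N (f u) (f v) (f w) (f x)" if "zigzag M u v w x" for u v w x
    using that c is_power_iso[OF assms(1,2) f]
    unfolding zigzag_def comparable_def by simp
  with assms(4) show ?thesis unfolding zigzag_free_def by blast
qed

lemma zigzag_free_DirProd_commute:
  assumes "group G" "group H" "zigzag_free (G \<times>\<times> H)"
  shows "zigzag_free (H \<times>\<times> G)"
  using zigzag_free_iso[OF DirProd_group[OF assms(2,1)] DirProd_group[OF assms(1,2)] _ assms(3)]
    DirProd_commute_iso by blast

lemma nat_pow_DirProd: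
  "(g, h) [^]\<^bsub>G \<times>\<times> H\<^esub> (n::nat) = (g [^]\<^bsub>G\<^esub> n, h [^]\<^bsub>H\<^esub> n)"
  by (induction n) (auto simp: nat_pow_def)

lemma is_power_DirProd:
  "is_power (G \<times>\<times> H) (g', h') (g, h) \<longleftrightarrow>
     (\<exists>n::nat. g' = g [^]\<^bsub>G\<^esub> n \<and> h' = h [^]\<^bsub>H\<^esub> n)"
  by (simp add: is_power_def nat_pow_DirProd)

section \<open>Groups without zigzags\<close>

lemma (in group) pow_eq_one_if_dvd:
  assumes "x [^] (n::nat) = \<one>" "n dvd m" "x \<in> carrier G"
  shows "x [^] m = \<one>"
  using assms by (metis dvd_trans pow_eq_id)

lemma (in group) pow_pow_eq_one:
  assumes "x [^] (n::nat) = \<one>" "x \<in> carrier G"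
  shows "(x [^] (m::nat)) [^] n = \<one>"
  using assms pow_eq_one_if_dvd[of x n "m * n"] by (simp add: nat_pow_pow)

lemma (in group) nat_pow_cong:
  assumes "x \<in> carrier G" "x [^] (n::nat) = \<one>" "[a = b] (mod n)"
  shows "x [^] a = x [^] b"
proof -
  have "ord x dvd n" using assms(1,2) pow_eq_id by blast
  then have "[a = b] (mod ord x)" using assms(3) cong_dvd_modulus_nat by blast
  then have "int (ord x) dvd int b - int a"
    by (metis cong_iff_dvd_diff cong_int_iff cong_sym)
  then show ?thesis using assms(1) int_pow_eq[of x "int a" "int b"] by (simp add: int_pow_int)
qed

text \<open>Bezout: some multiple of \<open>a\<close> is congruent to \<open>gcd a n\<close> modulo
  \<open>n\<close>, hence some multiple of \<open>a\<close> is congruent to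
  \<open>b\<close>.\<close>

lemma (in group) is_power_if_gcd_dvd:
  assumes "z \<in> carrier G" "z [^] (n::nat) = \<one>" "gcd a n dvd b"
  shows "is_power G (z [^] b) (z [^] a)"
proof -
  obtain t where t: "[a * t = gcd a n] (mod n)" using cong_solve_nat by blast
  obtain c where c: "b = gcd a n * c" using assms(3) by (rule dvdE)
  have "[a * t * c = b] (mod n)" using t c cong_scalar_right by blast
  then have "z [^] (a * t * c) = z [^] b" by (rule nat_pow_cong[OF assms(1,2)])
  then have "z [^] b = (z [^] a) [^] (t * c)" using assms(1) by (simp add: nat_pow_pow mult.assoc)
  then show ?thesis by (simp add: is_power_pow)
qed

text \<open>The subgroups of a cyclic p-group form a chain: the gcds of the two exponents with
  \<open>p ^ n\<close> are powers of \<open>p\<close>, so one divides the other.\<close>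

lemma (in group) powers_comparable_if_prime_power:
  assumes z: "z \<in> carrier G" "z [^] ((p::nat) ^ n) = \<one>" and p: "prime p"
    and u: "is_power G u z" and w: "is_power G w z"
  shows "comparable G u w"
proof -
  obtain a b :: nat where ab: "u = z [^] a" "w = z [^] b"
    using u w by (auto simp: is_power_def)
  obtain i where i: "gcd a (p ^ n) = p ^ i" using p divides_primepow_nat[of p "gcd a (p ^ n)" n] by auto
  obtain j where j: "gcd b (p ^ n) = p ^ j" using p divides_primepow_nat[of p "gcd b (p ^ n)" n] by auto
  have "gcd a (p ^ n) dvd b \<or> gcd b (p ^ n) dvd a"
  proof (cases "i \<le> j")
    case True
    then have "p ^ i dvd p ^ j" by (rule le_imp_power_dvd)
    then show ?thesis using i j by (metis dvd_trans gcd_dvd1)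
  next
    case False
    then have "p ^ j dvd p ^ i" by (intro le_imp_power_dvd) simp
    then show ?thesis using i j by (metis dvd_trans gcd_dvd1)
  qed
  then show ?thesis
    using is_power_if_gcd_dvd[OF z] ab unfolding comparable_def by blast
qed

lemma zigzag_free_if_prime_power_order:
  assumes "group M" "prime (p::nat)" "order M = p ^ n"
  shows "zigzag_free M"
proof -
  interpret group M by fact
  show ?thesis
    unfolding zigzag_free_def zigzag_def
    using powers_comparable_if_prime_power[OF _ _ assms(2)] pow_order_eq_1 assms(3)
    by (metis insert_subset)
qed

lemma (in group) is_power_if_prime_order:
  assumes "prime (order G)" "g \<in> carrier G" "g \<noteq> \<one>" "g' \<in> carrier G"
  shows "is_power G g' g"
proof -
  have fin: "finite (carrier G)"
    using prime_gt_0_nat[OF assms(1)] by (simp add: order_gt_0_iff_finite)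
  have "ord g \<noteq> 1" using assms(2,3) by (metis ord_eq_1)
  then have "ord g = order G"
    using ord_dvd_group_order[OF assms(2)] assms(1) by (metis prime_nat_iff)
  then have "card (generate G {g}) = card (carrier G)"
    using generate_pow_card[OF assms(2)] by (simp add: order_def)
  moreover have "generate G {g} \<subseteq> carrier G" using assms(2) by (intro generate_incl) simp
  ultimately have "generate G {g} = carrier G" using fin by (metis card_subset_eq)
  then show ?thesis
    using generate_pow_on_finite_carrier[OF fin assms(2)] assms(4) by (auto simp: is_power_def)
qed

lemma (in group) eq_one_if_coprime_pow:
  assumes "x \<in> carrier G" "x [^] (m::nat) = \<one>" "x [^] (n::nat) = \<one>" "coprime m n"
  shows "x = \<one>"
proof -
  have "ord x dvd m" "ord x dvd n" using assms pow_eq_id by blast+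
  then have "ord x = 1" using assms(4) by (metis coprime_common_divisor_nat)
  then show ?thesis using assms(1) ord_eq_1 by blast
qed

text \<open>Common core of cases (b) and (c). The top \<open>v\<close> of a zigzag lacks prime power
  order, which forces it to generate \<open>G\<close> times the subgroup generated by
  \<open>A\<close>. Since \<open>x\<close> lies outside that subgroup, its second coordinate has
  \<open>q\<close>-power order. Anything below both \<open>v\<close> and \<open>x\<close> is then
  trivial, but \<open>w\<close> is not.\<close>

lemma zigzag_free_prime_times_frobenius:
  fixes p q m :: nat
  assumes "group G" "group H" and p: "prime p" and q: "prime q" "p \<noteq> q" and G: "order G = q"
    and A: "A \<in> carrier H" "A [^]\<^bsub>H\<^esub> p = \<one>\<^bsub>H\<^esub>"
    and H: "\<And>h. h \<in> carrier H \<Longrightarrow> is_power H h A \<or> h [^]\<^bsub>H\<^esub> (q ^ m) = \<one>\<^bsub>H\<^esub>"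
  shows "zigzag_free (G \<times>\<times> H)"
proof -
  interpret G: group G by fact
  interpret H: group H by fact
  interpret GH: group "G \<times>\<times> H" by (intro DirProd_group assms)
  have Gq: "g [^]\<^bsub>G\<^esub> q = \<one>\<^bsub>G\<^esub>" if "g \<in> carrier G" for g
    using G.pow_order_eq_1[OF that] G by simp
  have pq: "coprime p q" using p q primes_coprime by blast
  have False if z: "zigzag (G \<times>\<times> H) u v w x" for u v w x
  proof -
    obtain v1 v2 x1 x2 where v: "v = (v1, v2)" and x: "x = (x1, x2)" by (metis surj_pair)
    have car: "v1 \<in> carrier G" "v2 \<in> carrier H" "x1 \<in> carrier G" "x2 \<in> carrier H"
      "w \<in> carrier (G \<times>\<times> H)" "v \<in> carrier (G \<times>\<times> H)"
      using z unfolding zigzag_def v x by auto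
    have uw: "is_power (G \<times>\<times> H) u v" "is_power (G \<times>\<times> H) w v" "is_power (G \<times>\<times> H) w x"
      and nc: "\<not> comparable (G \<times>\<times> H) u w" "\<not> comparable (G \<times>\<times> H) v x"
      using z by (auto simp: zigzag_def)
    \<comment> \<open>If \<open>v\<close> had prime power order, its powers \<open>u\<close> and
      \<open>w\<close> would be comparable.\<close>
    have nt: "v [^]\<^bsub>G \<times>\<times> H\<^esub> (r ^ n) \<noteq> \<one>\<^bsub>G \<times>\<times> H\<^esub>" if "prime r" for r n :: nat
      using GH.powers_comparable_if_prime_power[OF car(6) _ that uw(1,2)] nc(1) by blast
    have v2q: "v2 [^]\<^bsub>H\<^esub> (q ^ m) \<noteq> \<one>\<^bsub>H\<^esub>"
    proof
      assume *: "v2 [^]\<^bsub>H\<^esub> (q ^ m) = \<one>\<^bsub>H\<^esub>"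
      \<comment> \<open>The exponent \<open>Suc m\<close> kills both coordinates, also when
        \<open>m\<close> is 0.\<close>
      have "v1 [^]\<^bsub>G\<^esub> (q ^ Suc m) = \<one>\<^bsub>G\<^esub>"
        using G.pow_eq_one_if_dvd[OF Gq[OF car(1)] _ car(1)] by simp
      moreover have "v2 [^]\<^bsub>H\<^esub> (q ^ Suc m) = \<one>\<^bsub>H\<^esub>"
        using H.pow_eq_one_if_dvd[OF * _ car(2)] by simp
      ultimately show False using nt[OF q(1), of "Suc m"] by (simp add: v nat_pow_DirProd)
    qed
    then obtain i where i: "v2 = A [^]\<^bsub>H\<^esub> (i::nat)" using H[OF car(2)] by (auto simp: is_power_def)
    have v2p: "v2 [^]\<^bsub>H\<^esub> p = \<one>\<^bsub>H\<^esub>"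
      unfolding i using A by (intro H.pow_pow_eq_one)
    have v1: "v1 \<noteq> \<one>\<^bsub>G\<^esub>" using nt[OF p, of 1] v2p by (auto simp: v nat_pow_DirProd)
    have "\<not> p dvd i"
    proof
      assume "p dvd i"
      then have "v2 = \<one>\<^bsub>H\<^esub>" using H.pow_eq_one_if_dvd[OF A(2) _ A(1)] by (simp add: i)
      with v2q show False by simp
    qed
    then have ip: "gcd i p = 1" using p by (metis coprime_commute coprime_imp_gcd_eq_1 prime_imp_coprime)
    \<comment> \<open>Each coordinate is reached separately, since \<open>v1\<close> generates
      \<open>G\<close> and \<open>v2\<close> generates the same subgroup as \<open>A\<close>; the
      Chinese remainder theorem merges the two exponents.\<close>
    have full: "is_power (G \<times>\<times> H) (g, h) v" if g: "g \<in> carrier G" and h: "is_power H h A" for g h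
    proof -
      obtain a where a: "g = v1 [^]\<^bsub>G\<^esub> (a::nat)"
        using G.is_power_if_prime_order[of v1 g] G q v1 car g by (auto simp: is_power_def)
      obtain j where j: "h = A [^]\<^bsub>H\<^esub> (j::nat)" using h by (auto simp: is_power_def)
      obtain b where b: "h = v2 [^]\<^bsub>H\<^esub> (b::nat)"
        using H.is_power_if_gcd_dvd[OF A, of i j] ip by (auto simp: is_power_def i j)
      obtain n where n: "[n = a] (mod q)" "[n = b] (mod p)"
        using binary_chinese_remainder_nat[of q p a b] pq by (auto simp: coprime_commute)
      have "g = v1 [^]\<^bsub>G\<^esub> n" "h = v2 [^]\<^bsub>H\<^esub> n"
        using G.nat_pow_cong[OF car(1) Gq[OF car(1)] n(1)] H.nat_pow_cong[OF car(2) v2p n(2)] a b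
        by auto
      then show ?thesis unfolding v is_power_DirProd by blast
    qed
    have x2A: "\<not> is_power H x2 A" using full[OF car(3)] nc(2) by (auto simp: comparable_def x)
    with H[OF car(4)] have x2q: "x2 [^]\<^bsub>H\<^esub> (q ^ m) = \<one>\<^bsub>H\<^esub>" by blast
    obtain t :: nat where t: "w = (v1 [^]\<^bsub>G\<^esub> t, v2 [^]\<^bsub>H\<^esub> t)"
      using uw(2) by (auto simp: is_power_def v nat_pow_DirProd)
    obtain r :: nat where r: "w = (x1 [^]\<^bsub>G\<^esub> r, x2 [^]\<^bsub>H\<^esub> r)"
      using uw(3) by (auto simp: is_power_def x nat_pow_DirProd)
    \<comment> \<open>As a power of \<open>v2\<close> and of \<open>x2\<close>, the second
      coordinate of \<open>w\<close> is killed by the coprime numbers \<open>p\<close> and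
      \<open>q ^ m\<close>.\<close>
    have "(v2 [^]\<^bsub>H\<^esub> t) [^]\<^bsub>H\<^esub> p = \<one>\<^bsub>H\<^esub>"
      by (rule H.pow_pow_eq_one[OF v2p car(2)])
    moreover have "(x2 [^]\<^bsub>H\<^esub> r) [^]\<^bsub>H\<^esub> (q ^ m) = \<one>\<^bsub>H\<^esub>"
      by (rule H.pow_pow_eq_one[OF x2q car(4)])
    ultimately have x2r: "x2 [^]\<^bsub>H\<^esub> r = \<one>\<^bsub>H\<^esub>"
      using H.eq_one_if_coprime_pow[of "x2 [^]\<^bsub>H\<^esub> r" p "q ^ m"] pq t r car(4) by auto
    \<comment> \<open>Otherwise \<open>r\<close> and \<open>q ^ m\<close> are coprime and both kill
      \<open>x2\<close>, so \<open>x2\<close> would be trivial and hence a power of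
      \<open>A\<close>. Once \<open>q\<close> divides \<open>r\<close>, the first coordinate of
      \<open>w\<close> vanishes too.\<close>
    have "q dvd r"
    proof (rule ccontr)
      assume "\<not> q dvd r"
      then have "coprime r (q ^ m)" using q(1) by (simp add: coprime_commute prime_imp_coprime)
      then have "x2 = \<one>\<^bsub>H\<^esub>" using H.eq_one_if_coprime_pow[OF car(4) x2r x2q] by simp
      with x2A H.is_power_one show False by simp
    qed
    then have "x1 [^]\<^bsub>G\<^esub> r = \<one>\<^bsub>G\<^esub>" using G.pow_eq_one_if_dvd[OF Gq[OF car(3)] _ car(3)] by simp
    then have "w = \<one>\<^bsub>G \<times>\<times> H\<^esub>" using r x2r by simp
    then show False using nc(1) GH.is_power_one by (simp add: comparable_def)
  qed
  then show ?thesis unfolding zigzag_free_def by blast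
qed

section \<open>Computing with the relation of a metacyclic group\<close>

lemma (in group) metacyclic_swap:
  fixes k i j :: nat
  assumes x: "x \<in> carrier G" "b \<in> carrier G" and conj: "inv b \<otimes> x \<otimes> b = x [^] k"
  shows "x [^] i \<otimes> b [^] j = b [^] j \<otimes> x [^] (i * k ^ j)"
proof -
  have xb: "x \<otimes> b = b \<otimes> x [^] k"
    unfolding conj[symmetric] using x by (simp add: m_assoc[symmetric])
  have one: "x [^] i \<otimes> b = b \<otimes> x [^] (i * k)" for i :: nat
  proof (induction i)
    case (Suc i)
    have "x [^] Suc i \<otimes> b = x [^] i \<otimes> (x \<otimes> b)" using x by (simp add: m_assoc)
    also have "\<dots> = x [^] i \<otimes> b \<otimes> x [^] k" using x by (simp add: xb m_assoc)
    also have "\<dots> = b \<otimes> x [^] (Suc i * k)"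
      using x by (simp add: Suc m_assoc nat_pow_mult add.commute)
    finally show ?case .
  qed (use x in simp)
  show ?thesis
  proof (induction j arbitrary: i)
    case (Suc j)
    have "x [^] i \<otimes> b [^] Suc j = (x [^] i \<otimes> b [^] j) \<otimes> b" using x by (simp add: m_assoc)
    also have "\<dots> = b [^] j \<otimes> (x [^] (i * k ^ j) \<otimes> b)" using x by (simp add: Suc m_assoc)
    also have "\<dots> = b [^] Suc j \<otimes> x [^] (i * k ^ Suc j)"
      using x by (simp add: one m_assoc[symmetric] mult_ac)
    finally show ?case .
  qed (use x in simp)
qed

text \<open>Collecting all powers of \<open>b\<close> on the left multiplies each exponent of
  \<open>x\<close> by \<open>k ^ j\<close> for every block that it passes, which produces a
  geometric sum.\<close>

lemma (in group) metacyclic_pow: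
  fixes k i j n :: nat
  assumes x: "x \<in> carrier G" "b \<in> carrier G" and conj: "inv b \<otimes> x \<otimes> b = x [^] k"
  shows "(b [^] j \<otimes> x [^] i) [^] n = b [^] (j * n) \<otimes> x [^] (i * (\<Sum>t<n. (k ^ j) ^ t))"
proof (induction n)
  case (Suc n)
  let ?S = "\<lambda>n. \<Sum>t<n. (k ^ j) ^ t"
  \<comment> \<open>The sum is peeled at its first term: the old blocks of \<open>x\<close> pass one
    more \<open>b [^] j\<close>, and the new block passes none.\<close>
  have S: "?S (Suc n) = 1 + k ^ j * ?S n"
    by (simp add: sum.lessThan_Suc_shift sum_distrib_left del: sum.lessThan_Suc)
  have "(b [^] j \<otimes> x [^] i) [^] Suc n = b [^] (j * n) \<otimes> (x [^] (i * ?S n) \<otimes> b [^] j) \<otimes> x [^] i"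
    using x by (simp add: Suc m_assoc)
  also have "\<dots> = (b [^] (j * n) \<otimes> b [^] j) \<otimes> (x [^] (i * ?S n * k ^ j) \<otimes> x [^] i)"
    using x by (simp add: metacyclic_swap[OF x conj] m_assoc)
  also have "\<dots> = b [^] (j * Suc n) \<otimes> x [^] (i * ?S (Suc n))"
    unfolding S using x by (simp add: nat_pow_mult algebra_simps)
  finally show ?case .
qed (use x in simp)

text \<open>\<open>K - 1\<close> times the sum is \<open>K ^ n - 1\<close>. The argument runs in the
  integers, where the subtraction is harmless.\<close>

lemma prime_dvd_geometric_sum:
  fixes p K n :: nat
  assumes "prime p" "[K ^ n = 1] (mod p)" "\<not> [K = 1] (mod p)"
  shows "p dvd (\<Sum>t<n. K ^ t)"
proof -
  have "int p dvd int K ^ n - 1"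
    using assms(2) by (metis cong_iff_dvd_diff cong_int_iff of_nat_1 of_nat_power)
  then have "int p dvd (int K - 1) * (\<Sum>t<n. int K ^ t)" by (simp add: power_diff_1_eq)
  moreover have "\<not> int p dvd int K - 1"
    using assms(3) by (metis cong_iff_dvd_diff cong_int_iff of_nat_1)
  ultimately have "int p dvd (\<Sum>t<n. int K ^ t)"
    using assms(1) by (simp add: prime_dvd_mult_iff)
  then have "int p dvd int (\<Sum>t<n. K ^ t)" by simp
  then show ?thesis by (simp only: int_dvd_int_iff)
qed

text \<open>If \<open>n\<close> divides \<open>j\<close>, the factor \<open>b [^] j\<close>
  disappears. If not, \<open>k ^ j\<close> is a nontrivial \<open>n\<close>-th root of unity modulo
  \<open>p\<close>, so the geometric sum in the \<open>n\<close>-th power vanishes modulo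
  \<open>p\<close>.\<close>

lemma (in group) metacyclic_power_or_pow_eq_one:
  fixes p n k i j :: nat
  assumes x: "x \<in> carrier G" "b \<in> carrier G" and conj: "inv b \<otimes> x \<otimes> b = x [^] k"
    and p: "prime p" and xp: "x [^] p = \<one>" and bn: "b [^] n = \<one>" and ord: "Pocklington.ord p k = n"
  shows "is_power G (b [^] j \<otimes> x [^] i) x \<or> (b [^] j \<otimes> x [^] i) [^] n = \<one>"
proof (cases "n dvd j")
  case True
  then have "b [^] j = \<one>" using pow_eq_one_if_dvd[OF bn] x by simp
  then show ?thesis using x by (simp add: is_power_pow)
next
  case False
  have "\<not> [k ^ j = 1] (mod p)" using False ord ord_divides by blast
  moreover have "[(k ^ j) ^ n = 1] (mod p)"
    using ord by (metis dvd_triv_right ord_divides power_mult)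
  ultimately have "p dvd (\<Sum>t<n. (k ^ j) ^ t)" by (intro prime_dvd_geometric_sum p)
  then have "p dvd i * (\<Sum>t<n. (k ^ j) ^ t)" by simp
  then have "x [^] (i * (\<Sum>t<n. (k ^ j) ^ t)) = \<one>" using pow_eq_one_if_dvd[OF xp] x by simp
  moreover have "b [^] (j * n) = \<one>" using pow_eq_one_if_dvd[OF bn] x by simp
  ultimately show ?thesis using metacyclic_pow[OF x conj] x by simp
qed

section \<open>Presentations\<close>

definition word_eval :: "('a, 'm) monoid_scheme \<Rightarrow> ('g \<Rightarrow> 'a) \<Rightarrow> 'g word \<Rightarrow> 'a" where
  "word_eval M f w = foldr (\<lambda>(x, e) g. (if e then f x else inv\<^bsub>M\<^esub> f x) \<otimes>\<^bsub>M\<^esub> g) w \<one>\<^bsub>M\<^esub>"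

lemma word_eval_Nil [simp]: "word_eval M f [] = \<one>\<^bsub>M\<^esub>"
  by (simp add: word_eval_def)

lemma word_eval_Cons [simp]:
  "word_eval M f ((x, e) # w) = (if e then f x else inv\<^bsub>M\<^esub> f x) \<otimes>\<^bsub>M\<^esub> word_eval M f w"
  by (simp add: word_eval_def)

context group
begin

lemma word_eval_closed:
  assumes "\<And>x. f x \<in> carrier G"
  shows "word_eval G f w \<in> carrier G"
  using assms by (induction w) auto

lemma word_eval_append:
  assumes "\<And>x. f x \<in> carrier G"
  shows "word_eval G f (u @ v) = word_eval G f u \<otimes> word_eval G f v"
  using assms by (induction u) (auto simp: word_eval_closed m_assoc)

lemma word_eval_replicate:
  assumes "\<And>x. f x \<in> carrier G"
  shows "word_eval G f (replicate n (x, e)) = (if e then f x else inv f x) [^] n"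
proof (induction n)
  case (Suc n)
  have "y \<otimes> y [^] n = y [^] n \<otimes> y" if "y \<in> carrier G" for y
    using that by (metis nat_pow_Suc nat_pow_Suc2)
  then show ?case using Suc assms by simp
qed simp

lemma word_eval_gen_pow:
  assumes "\<And>x. f x \<in> carrier G"
  shows "word_eval G f (gen_pow x n) = f x [^] n"
proof (cases "n \<ge> 0")
  case True
  then show ?thesis
    using assms by (simp add: gen_pow_def word_eval_replicate flip: int_pow_int)
next
  case False
  then have "f x [^] n = inv (f x [^] nat \<bar>n\<bar>)"
    using assms int_pow_neg_int[of "f x" "nat \<bar>n\<bar>"] by simp
  then show ?thesis
    using False by (simp only: gen_pow_def word_eval_replicate[OF assms] if_False nat_pow_inv[OF assms])
qed

lemma word_eval_cong:
  assumes f: "\<And>x. f x \<in> carrier G"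
    and R: "\<And>u v. (u, v) \<in> R \<Longrightarrow> word_eval G f u = word_eval G f v"
    and "word_eq R u v"
  shows "word_eval G f u = word_eval G f v"
  using assms(3) by induction (auto simp: word_eval_append f R)

end

lemma presented_group_carrier:
  "carrier (presented_group R) = range (\<lambda>w. word_rel R `` {w})"
  by (auto simp: presented_group_def quotient_def)

lemma presented_group_one: "\<one>\<^bsub>presented_group R\<^esub> = word_rel R `` {[]}"
  by (simp add: presented_group_def)

lemma word_class_eqI:
  assumes "word_eq R u v"
  shows "word_rel R `` {u} = word_rel R `` {v}"
  using assms by (intro equiv_class_eq[OF equiv_word_rel]) (simp add: word_rel_def)

text \<open>Hence a defining relation, evaluated at the classes of the generators, becomes an
  equation between elements of the presented group.\<close>

lemma word_eval_presented_group:
  "word_eval (presented_group R) (\<lambda>x. word_rel R `` {[(x, True)]}) w = word_rel R `` {w}"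
proof (induction w)
  case (Cons l w)
  let ?P = "presented_group R" and ?c = "\<lambda>w. word_rel R `` {w}"
  interpret P: group ?P by (rule group_presented_group)
  obtain x e where l: "l = (x, e)" by (cases l)
  have car: "?c u \<in> carrier ?P" for u by (auto simp: presented_group_carrier)
  have "?c [(x, False)] \<otimes>\<^bsub>?P\<^esub> ?c [(x, True)] = \<one>\<^bsub>?P\<^esub>"
    unfolding presented_group_mult presented_group_one
    using word_eq_cancel[of R x False] by (intro word_class_eqI) simp
  then have "inv\<^bsub>?P\<^esub> ?c [(x, True)] = ?c [(x, False)]" using car by (intro P.inv_equality) auto
  then have "(if e then ?c [(x, True)] else inv\<^bsub>?P\<^esub> ?c [(x, True)]) = ?c [l]" by (simp add: l)
  then show ?case using Cons by (simp add: l presented_group_mult)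
qed (simp add: presented_group_one)

text \<open>Von Dyck's theorem: evaluation of words respects the relations, so it factors through
  the classes.\<close>

lemma presented_group_hom:
  fixes f :: "'g \<Rightarrow> 'a"
  assumes "group M" and f: "\<And>x. f x \<in> carrier M"
    and R: "\<And>u v. (u, v) \<in> R \<Longrightarrow> word_eval M f u = word_eval M f v"
  obtains \<phi> where "\<phi> \<in> hom (presented_group R) M"
    "\<And>x. \<phi> (word_rel R `` {[(x, True)]}) = f x"
proof -
  interpret group M by fact
  \<comment> \<open>The choice of a representative does not matter, by
    \<open>word_eval_cong\<close>; the next fact records this.\<close>
  define \<phi> where "\<phi> X = word_eval M f (SOME u. X = word_rel R `` {u})" for X
  have \<phi>: "\<phi> (word_rel R `` {u}) = word_eval M f u" for u
  proof -
    let ?v = "SOME v. word_rel R `` {u} = word_rel R `` {v}"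
    have "word_rel R `` {u} = word_rel R `` {?v}" by (rule someI) (rule refl)
    then have "(u, ?v) \<in> word_rel R" by (rule eq_equiv_class[OF _ equiv_word_rel UNIV_I])
    then have "word_eq R u ?v" by (simp add: word_rel_def)
    then show ?thesis unfolding \<phi>_def using word_eval_cong[OF f R] by metis
  qed
  have "\<phi> \<in> hom (presented_group R) M"
  proof (rule homI)
    show "\<phi> X \<in> carrier M" if "X \<in> carrier (presented_group R)" for X
      using that by (auto simp: presented_group_carrier \<phi> word_eval_closed f)
    show "\<phi> (X \<otimes>\<^bsub>presented_group R\<^esub> Y) = \<phi> X \<otimes>\<^bsub>M\<^esub> \<phi> Y"
      if "X \<in> carrier (presented_group R)" "Y \<in> carrier (presented_group R)" for X Y
      using that by (auto simp: presented_group_carrier presented_group_mult \<phi> word_eval_append f)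
  qed
  moreover have "\<phi> (word_rel R `` {[(x, True)]}) = f x" for x using f by (simp add: \<phi>)
  ultimately show ?thesis by (rule that)
qed

definition metacyclic_rels :: "nat \<Rightarrow> nat \<Rightarrow> int \<Rightarrow> (gen_ab word \<times> gen_ab word) set" where
  "metacyclic_rels r s k =
     {(gen_pow gen_a (int r), []),
      (gen_pow gen_b (int s), []),
      (gen_pow gen_b (- 1) @ gen_pow gen_a 1 @ gen_pow gen_b 1, gen_pow gen_a k)}"

lemma metacyclic_pres_eq: "metacyclic_pres r s k = presented_group (metacyclic_rels r s k)"
  by (simp add: metacyclic_pres_def metacyclic_rels_def)

text \<open>Translates between relations of words and equations in a group. It is read in one
  direction inside the presented group and in the other for maps out of it.\<close>

lemma (in group) word_eval_metacyclic_rels: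
  assumes f: "\<And>x. f x \<in> carrier G"
  shows "(\<forall>(u, v) \<in> metacyclic_rels r s k. word_eval G f u = word_eval G f v) \<longleftrightarrow>
    f gen_a [^] r = \<one> \<and> f gen_b [^] s = \<one> \<and>
    inv (f gen_b) \<otimes> f gen_a \<otimes> f gen_b = f gen_a [^] k"
proof -
  have "f x [^] (- 1 :: int) = inv (f x)" "f x [^] (1 :: int) = f x" for x
    using f int_pow_neg[of "f x" 1] by auto
  then show ?thesis
    by (simp add: metacyclic_rels_def word_eval_append word_eval_gen_pow f int_pow_int m_assoc)
qed

lemma (in group) inv_eq_pow:
  assumes "z \<in> carrier G" "z [^] (r::nat) = \<one>" "r > 0"
  shows "inv z = z [^] (r - 1)"
proof (rule inv_equality)
  have "z [^] Suc (r - 1) = \<one>" using assms by simp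
  then show "z [^] (r - 1) \<otimes> z = \<one>" by (simp only: nat_pow_Suc)
qed (use assms in simp_all)

text \<open>The last claim gives existence of a normal form, by moving powers of \<open>A\<close> to
  the right past powers of \<open>B\<close>. It bounds the presented group from above; uniqueness is
  not asserted.\<close>

lemma metacyclic_pres_generators:
  fixes p n :: nat and k :: int
  assumes "p > 0" "n > 0"
  defines "P \<equiv> metacyclic_pres p n k"
    and "A \<equiv> word_rel (metacyclic_rels p n k) `` {[(gen_a, True)]}"
    and "B \<equiv> word_rel (metacyclic_rels p n k) `` {[(gen_b, True)]}"
  shows "A \<in> carrier P" "B \<in> carrier P" "A [^]\<^bsub>P\<^esub> p = \<one>\<^bsub>P\<^esub>" "B [^]\<^bsub>P\<^esub> n = \<one>\<^bsub>P\<^esub>"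
    "inv\<^bsub>P\<^esub> B \<otimes>\<^bsub>P\<^esub> A \<otimes>\<^bsub>P\<^esub> B = A [^]\<^bsub>P\<^esub> nat (k mod int p)"
    "X \<in> carrier P \<Longrightarrow> \<exists>(j::nat) (i::nat). X = B [^]\<^bsub>P\<^esub> j \<otimes>\<^bsub>P\<^esub> A [^]\<^bsub>P\<^esub> i"
proof -
  let ?R = "metacyclic_rels p n k"
  interpret P: group P by (simp add: P_def metacyclic_pres_eq group_presented_group)
  define f where "f = (\<lambda>x. word_rel ?R `` {[(x, True)]})"
  have AB: "A = f gen_a" "B = f gen_b" by (simp_all add: f_def A_def B_def)
  have f: "f x \<in> carrier P" for x
    by (auto simp: f_def P_def metacyclic_pres_eq presented_group_carrier)
  have ev: "word_eval P f w = word_rel ?R `` {w}" for w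
    unfolding f_def P_def metacyclic_pres_eq by (rule word_eval_presented_group)
  have "\<forall>(u, v) \<in> ?R. word_eval P f u = word_eval P f v"
    unfolding ev by (auto intro!: word_class_eqI word_eq_rel)
  then have rel': "A [^]\<^bsub>P\<^esub> p = \<one>\<^bsub>P\<^esub>" "B [^]\<^bsub>P\<^esub> n = \<one>\<^bsub>P\<^esub>"
    "inv\<^bsub>P\<^esub> B \<otimes>\<^bsub>P\<^esub> A \<otimes>\<^bsub>P\<^esub> B = A [^]\<^bsub>P\<^esub> k"
    unfolding P.word_eval_metacyclic_rels[OF f] AB by auto
  show car: "A \<in> carrier P" "B \<in> carrier P" using f AB by auto
  \<comment> \<open>The exponent \<open>k\<close> may be negative. As \<open>A\<close> has finite
    order, it can be replaced by its residue modulo \<open>p\<close>, a natural number to which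
    \<open>metacyclic_swap\<close> applies.\<close>
  let ?k = "nat (k mod int p)"
  have "int (P.ord A) dvd int p" using rel'(1) car(1) by (simp add: P.pow_eq_id)
  moreover have "int p dvd k mod int p - k" by (metis cong_iff_dvd_diff cong_mod_left cong_refl)
  ultimately have "A [^]\<^bsub>P\<^esub> k = A [^]\<^bsub>P\<^esub> (k mod int p)"
    using P.int_pow_eq[OF car(1)] dvd_trans by blast
  also have "k mod int p = int ?k" using assms(1) by simp
  finally have "A [^]\<^bsub>P\<^esub> k = A [^]\<^bsub>P\<^esub> ?k" by (simp only: int_pow_int)
  with rel' show rel: "A [^]\<^bsub>P\<^esub> p = \<one>\<^bsub>P\<^esub>" "B [^]\<^bsub>P\<^esub> n = \<one>\<^bsub>P\<^esub>"
    "inv\<^bsub>P\<^esub> B \<otimes>\<^bsub>P\<^esub> A \<otimes>\<^bsub>P\<^esub> B = A [^]\<^bsub>P\<^esub> ?k" by simp_all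
  note inv = P.inv_eq_pow[OF car(1) rel(1) assms(1)] P.inv_eq_pow[OF car(2) rel(2) assms(2)]
  \<comment> \<open>Inverse letters need no negative exponents: the inverses are the powers with
    exponents \<open>p - 1\<close> and \<open>n - 1\<close>.\<close>
  have letter: "\<exists>(c::nat) (d::nat). (if e then f x else inv\<^bsub>P\<^esub> f x) = B [^]\<^bsub>P\<^esub> d \<otimes>\<^bsub>P\<^esub> A [^]\<^bsub>P\<^esub> c" for x e
  proof -
    have "f x = B [^]\<^bsub>P\<^esub> (if x = gen_b then 1 else 0::nat) \<otimes>\<^bsub>P\<^esub> A [^]\<^bsub>P\<^esub> (if x = gen_a then 1 else 0::nat)"
      using car by (cases x) (simp_all add: AB)
    moreover have "inv\<^bsub>P\<^esub> f x = B [^]\<^bsub>P\<^esub> (if x = gen_b then n - 1 else 0) \<otimes>\<^bsub>P\<^esub> A [^]\<^bsub>P\<^esub> (if x = gen_a then p - 1 else 0)"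
      using car inv by (cases x) (simp_all add: AB)
    ultimately show ?thesis by (cases e) (simp_all only: if_True if_False, blast+)
  qed
  have nf: "\<exists>(j::nat) (i::nat). word_eval P f w = B [^]\<^bsub>P\<^esub> j \<otimes>\<^bsub>P\<^esub> A [^]\<^bsub>P\<^esub> i" for w
  proof (induction w)
    case Nil
    have "\<one>\<^bsub>P\<^esub> = B [^]\<^bsub>P\<^esub> (0::nat) \<otimes>\<^bsub>P\<^esub> A [^]\<^bsub>P\<^esub> (0::nat)" using car by simp
    then show ?case by (metis word_eval_Nil)
  next
    case (Cons l w)
    obtain x e where l: "l = (x, e)" by (cases l)
    obtain i j where w: "word_eval P f w = B [^]\<^bsub>P\<^esub> (j::nat) \<otimes>\<^bsub>P\<^esub> A [^]\<^bsub>P\<^esub> (i::nat)" using Cons by blast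
    obtain c d where cd: "(if e then f x else inv\<^bsub>P\<^esub> f x) = B [^]\<^bsub>P\<^esub> (d::nat) \<otimes>\<^bsub>P\<^esub> A [^]\<^bsub>P\<^esub> (c::nat)"
      using letter by blast
    have "word_eval P f (l # w) = B [^]\<^bsub>P\<^esub> d \<otimes>\<^bsub>P\<^esub> (A [^]\<^bsub>P\<^esub> c \<otimes>\<^bsub>P\<^esub> B [^]\<^bsub>P\<^esub> j) \<otimes>\<^bsub>P\<^esub> A [^]\<^bsub>P\<^esub> i"
      unfolding l word_eval_Cons w cd using car by (simp add: P.m_assoc)
    also have "\<dots> = (B [^]\<^bsub>P\<^esub> d \<otimes>\<^bsub>P\<^esub> B [^]\<^bsub>P\<^esub> j) \<otimes>\<^bsub>P\<^esub> (A [^]\<^bsub>P\<^esub> (c * ?k ^ j) \<otimes>\<^bsub>P\<^esub> A [^]\<^bsub>P\<^esub> i)"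
      unfolding P.metacyclic_swap[OF car rel(3)] using car by (simp add: P.m_assoc)
    also have "\<dots> = B [^]\<^bsub>P\<^esub> (d + j) \<otimes>\<^bsub>P\<^esub> A [^]\<^bsub>P\<^esub> (c * ?k ^ j + i)" using car by (simp add: P.nat_pow_mult)
    finally show ?case by blast
  qed
  show "\<exists>(j::nat) (i::nat). X = B [^]\<^bsub>P\<^esub> j \<otimes>\<^bsub>P\<^esub> A [^]\<^bsub>P\<^esub> i" if "X \<in> carrier P"
  proof -
    have "X \<in> range (\<lambda>w. word_rel ?R `` {w})"
      using that unfolding P_def metacyclic_pres_eq presented_group_carrier .
    then obtain w where "X = word_rel ?R `` {w}" by blast
    then show ?thesis using nf[of w] ev[of w] by simp
  qed
qed

section \<open>Zigzag-freeness in case (c)\<close>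

lemma ord_int_mod:
  assumes "p > 0"
  shows "Pocklington.ord (int p) k = Pocklington.ord p (nat (k mod int p))"
proof -
  let ?K = "nat (k mod int p)"
  have K: "int ?K = k mod int p" using assms by simp
  have "[k ^ d = 1] (mod int p) \<longleftrightarrow> [?K ^ d = 1] (mod p)" for d
  proof -
    have "[?K ^ d = 1] (mod p) \<longleftrightarrow> [int ?K ^ d = 1] (mod int p)"
      by (metis cong_int_iff of_nat_1 of_nat_power)
    then show ?thesis by (simp only: K cong_def power_mod)
  qed
  moreover have "coprime (int p) k \<longleftrightarrow> coprime p ?K"
  proof -
    have "coprime p ?K \<longleftrightarrow> coprime (int p) (k mod int p)" by (metis K coprime_int_iff)
    then show ?thesis using assms by (simp add: coprime_commute)
  qed
  ultimately show ?thesis by (simp add: ord_def)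
qed

lemma metacyclic_pres_dichotomy:
  fixes p n :: nat
  assumes p: "prime p" and n: "n > 0" and k: "Pocklington.ord (int p) k = n"
  shows "\<exists>A \<in> carrier (metacyclic_pres p n k). A [^]\<^bsub>metacyclic_pres p n k\<^esub> p = \<one>\<^bsub>metacyclic_pres p n k\<^esub> \<and>
    (\<forall>h \<in> carrier (metacyclic_pres p n k). is_power (metacyclic_pres p n k) h A \<or>
       h [^]\<^bsub>metacyclic_pres p n k\<^esub> n = \<one>\<^bsub>metacyclic_pres p n k\<^esub>)"
proof -
  let ?P = "metacyclic_pres p n k"
  interpret P: group ?P by (simp add: metacyclic_pres_eq group_presented_group)
  have p0: "p > 0" using p prime_gt_0_nat by blast
  note gen = metacyclic_pres_generators[OF p0 n, where k = k]
  have "Pocklington.ord p (nat (k mod int p)) = n" using k ord_int_mod[OF p0] by simp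
  note d = P.metacyclic_power_or_pow_eq_one[OF gen(1,2,5) p gen(3,4) this]
  show ?thesis using gen(1,3) gen(6) d by metis
qed

lemma zigzag_free_prime_times_metacyclic:
  fixes p q m :: nat
  assumes "group G" "group H" "prime p" "prime q" "p \<noteq> q" "order G = q"
    and k: "Pocklington.ord (int p) k = q ^ m" and iso: "H \<cong> metacyclic_pres p (q ^ m) k"
  shows "zigzag_free (G \<times>\<times> H)"
proof -
  let ?P = "metacyclic_pres p (q ^ m) k"
  have P: "group ?P" by (simp add: metacyclic_pres_eq group_presented_group)
  have q0: "q ^ m > 0" using assms(4) prime_gt_0_nat by simp
  obtain A where A: "A \<in> carrier ?P" "A [^]\<^bsub>?P\<^esub> p = \<one>\<^bsub>?P\<^esub>"
    and dich: "\<And>h. h \<in> carrier ?P \<Longrightarrow> is_power ?P h A \<or> h [^]\<^bsub>?P\<^esub> (q ^ m) = \<one>\<^bsub>?P\<^esub>"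
    using metacyclic_pres_dichotomy[OF assms(3) q0 k] by blast
  obtain f where f: "f \<in> iso ?P H"
    using group.iso_sym[OF assms(2) iso] by (auto simp: is_iso_def)
  then have fh: "f \<in> hom ?P H" and sur: "f ` carrier ?P = carrier H"
    by (auto simp: iso_def bij_betw_def)
  have f1: "f \<one>\<^bsub>?P\<^esub> = \<one>\<^bsub>H\<^esub>" using hom_one[OF fh P assms(2)] .
  show ?thesis
  proof (rule zigzag_free_prime_times_frobenius[OF assms(1-6)])
    show "f A \<in> carrier H" using A sur by blast
    show "f A [^]\<^bsub>H\<^esub> p = \<one>\<^bsub>H\<^esub>"
      unfolding hom_nat_pow[OF P assms(2) fh A(1), symmetric] A(2) by (rule f1)
    show "is_power H h (f A) \<or> h [^]\<^bsub>H\<^esub> (q ^ m) = \<one>\<^bsub>H\<^esub>" if h: "h \<in> carrier H" for h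
    proof -
      obtain h' where h': "h' \<in> carrier ?P" "h = f h'"
        using h unfolding sur[symmetric] by (elim imageE)
      show ?thesis
        unfolding h'(2) is_power_iso[OF P assms(2) f h'(1) A(1)]
          hom_nat_pow[OF P assms(2) fh h'(1), symmetric]
        using dich[OF h'(1)] f1 by metis
    qed
  qed
qed

section \<open>Recognising a group by its metacyclic presentation\<close>

lemma (in group) is_power_inv:
  assumes "z \<in> carrier G" "z [^] (n::nat) = \<one>" "n > 0"
  shows "is_power G (inv z) z"
  using inv_eq_pow[OF assms] is_power_pow by simp

lemma (in group) is_power_mult:
  assumes "is_power G u z" "is_power G v z" "z \<in> carrier G"
  shows "is_power G (u \<otimes> v) z"
  using assms by (auto simp: is_power_def nat_pow_mult)

text \<open>Von Dyck's theorem gives a homomorphism, surjective by \<open>all\<close>. For the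
  kernel, a normal form mapping to the identity puts \<open>b [^] j\<close> among the powers of
  \<open>x\<close>; so \<open>n\<close> divides \<open>j\<close>, then \<open>p\<close> divides
  \<open>i\<close>, and the normal form is trivial already in the presented group.\<close>

lemma (in group) metacyclic_pres_iso:
  fixes p n k :: nat
  assumes x: "x \<in> carrier G" "b \<in> carrier G" and ord: "ord x = p" "p > 0" and n: "n > 0"
    and bn: "b [^] n = \<one>" and conj: "inv b \<otimes> x \<otimes> b = x [^] k"
    and bj: "\<And>j::nat. is_power G (b [^] j) x \<Longrightarrow> n dvd j"
    and all: "\<And>g. g \<in> carrier G \<Longrightarrow> \<exists>(j::nat) (i::nat). g = b [^] j \<otimes> x [^] i"
  shows "metacyclic_pres p n (int k) \<cong> G"
proof -
  let ?P = "metacyclic_pres p n (int k)" and ?R = "metacyclic_rels p n (int k)"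
  interpret P: group ?P by (simp add: metacyclic_pres_eq group_presented_group)
  note gen = metacyclic_pres_generators[OF ord(2) n, where k = "int k"]
  let ?A = "word_rel ?R `` {[(gen_a, True)]}" and ?B = "word_rel ?R `` {[(gen_b, True)]}"
  define f where "f = (\<lambda>g. case g of gen_a \<Rightarrow> x | gen_b \<Rightarrow> b)"
  have f: "f g \<in> carrier G" for g using x by (cases g) (auto simp: f_def)
  have xp: "x [^] p = \<one>" using ord x by auto
  have "\<forall>(u, v) \<in> ?R. word_eval G f u = word_eval G f v"
    unfolding word_eval_metacyclic_rels[OF f] using xp bn conj by (simp add: f_def int_pow_int)
  then obtain \<phi> where \<phi>: "\<phi> \<in> hom ?P G"
    and \<phi>f: "\<And>g. \<phi> (word_rel ?R `` {[(g, True)]}) = f g"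
    using presented_group_hom[of G f ?R] f group_axioms unfolding metacyclic_pres_eq by blast
  interpret \<phi>: group_hom ?P G \<phi> using \<phi> by unfold_locales
  have val: "\<phi> (?B [^]\<^bsub>?P\<^esub> j \<otimes>\<^bsub>?P\<^esub> ?A [^]\<^bsub>?P\<^esub> i) = b [^] j \<otimes> x [^] i" for i j :: nat
    using gen(1,2) by (simp add: \<phi>.hom_nat_pow \<phi>f f_def)
  have "X = \<one>\<^bsub>?P\<^esub>" if X: "X \<in> carrier ?P" "\<phi> X = \<one>" for X
  proof -
    obtain j i where ji: "X = ?B [^]\<^bsub>?P\<^esub> (j::nat) \<otimes>\<^bsub>?P\<^esub> ?A [^]\<^bsub>?P\<^esub> (i::nat)" using gen(6)[OF X(1)] by blast
    have e: "b [^] j \<otimes> x [^] i = \<one>" using X(2) val ji by simp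
    then have "b [^] j = inv (x [^] i)" using x by (metis inv_equality nat_pow_closed)
    moreover have "is_power G (inv (x [^] i)) x"
      using is_power_inv[OF _ pow_pow_eq_one[OF xp x(1)] ord(2)] is_power_trans is_power_pow x
      by (metis nat_pow_closed)
    ultimately have nj: "n dvd j" using bj by simp
    then have "x [^] i = \<one>" using e pow_eq_one_if_dvd[OF bn nj x(2)] x by simp
    then have "p dvd i" using x ord pow_eq_id by blast
    then have "?A [^]\<^bsub>?P\<^esub> i = \<one>\<^bsub>?P\<^esub>" by (rule P.pow_eq_one_if_dvd[OF gen(3) _ gen(1)])
    moreover have "?B [^]\<^bsub>?P\<^esub> j = \<one>\<^bsub>?P\<^esub>" by (rule P.pow_eq_one_if_dvd[OF gen(4) nj gen(2)])
    ultimately show ?thesis by (simp add: ji)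
  qed
  moreover have "\<phi> ` carrier ?P = carrier G"
  proof
    show "carrier G \<subseteq> \<phi> ` carrier ?P"
    proof
      fix g assume "g \<in> carrier G"
      then obtain j i where "g = b [^] (j::nat) \<otimes> x [^] (i::nat)" using all by blast
      then have "g = \<phi> (?B [^]\<^bsub>?P\<^esub> j \<otimes>\<^bsub>?P\<^esub> ?A [^]\<^bsub>?P\<^esub> i)" using val by simp
      then show "g \<in> \<phi> ` carrier ?P" using gen(1,2) by blast
    qed
  qed auto
  ultimately have "\<phi> \<in> iso ?P G" using \<phi>.iso_iff by blast
  then show ?thesis by (auto simp: is_iso_def)
qed

section \<open>The structure of zigzag-free products\<close>

text \<open>A nontrivial power of an element of prime order has an exponent coprime to the order, so
  it generates the same subgroup.\<close>

lemma (in group) is_power_prime_sym: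
  assumes "z \<in> carrier G" "prime (ord z)" "is_power G u z" "u \<noteq> \<one>"
  shows "is_power G z u"
proof -
  obtain n where n: "u = z [^] (n::nat)" using assms(3) by (auto simp: is_power_def)
  have "\<not> ord z dvd n" using assms(1,4) n pow_eq_id by blast
  then have "gcd n (ord z) = 1"
    using assms(2) by (metis coprime_commute coprime_imp_gcd_eq_1 prime_imp_coprime)
  then show ?thesis
    using is_power_if_gcd_dvd[OF assms(1) pow_ord_eq_1[OF assms(1)], of n 1] n assms(1) by simp
qed

lemma (in group) nat_pow_eq_iff_cong:
  assumes "x \<in> carrier G"
  shows "x [^] (a::nat) = x [^] b \<longleftrightarrow> [a = b] (mod ord x)"
  using int_pow_eq[OF assms, of "int a" "int b"]
  by (metis cong_iff_dvd_diff cong_int_iff cong_sym_eq int_pow_int)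

lemma is_power_DirProd_components:
  fixes p q :: nat
  assumes "group G" "group H" "x \<in> carrier G" "y \<in> carrier H"
    and "x [^]\<^bsub>G\<^esub> p = \<one>\<^bsub>G\<^esub>" "y [^]\<^bsub>H\<^esub> q = \<one>\<^bsub>H\<^esub>" "coprime p q"
  shows "is_power (G \<times>\<times> H) (x, \<one>\<^bsub>H\<^esub>) (x, y)" "is_power (G \<times>\<times> H) (\<one>\<^bsub>G\<^esub>, y) (x, y)"
proof -
  interpret G: group G by fact
  interpret H: group H by fact
  obtain m where m: "[m = 1] (mod p)" "[m = 0] (mod q)"
    using binary_chinese_remainder_nat[OF assms(7)] by blast
  obtain n where n: "[n = 0] (mod p)" "[n = 1] (mod q)"
    using binary_chinese_remainder_nat[OF assms(7)] by blast
  have "x [^]\<^bsub>G\<^esub> m = x" "y [^]\<^bsub>H\<^esub> m = \<one>\<^bsub>H\<^esub>" "x [^]\<^bsub>G\<^esub> n = \<one>\<^bsub>G\<^esub>" "y [^]\<^bsub>H\<^esub> n = y"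
    using G.nat_pow_cong[OF assms(3,5) m(1)] H.nat_pow_cong[OF assms(4,6) m(2)]
      G.nat_pow_cong[OF assms(3,5) n(1)] H.nat_pow_cong[OF assms(4,6) n(2)] assms(3,4) by auto
  then show "is_power (G \<times>\<times> H) (x, \<one>\<^bsub>H\<^esub>) (x, y)" "is_power (G \<times>\<times> H) (\<one>\<^bsub>G\<^esub>, y) (x, y)"
    unfolding is_power_DirProd by metis+
qed

locale zigzag_free_product = G: group G + H: group H
  for G :: "('a, 'm) monoid_scheme" and H :: "('b, 'n) monoid_scheme" +
  fixes x :: 'a and y :: 'b and p q :: nat
  assumes finite_G: "finite (carrier G)" and finite_H: "finite (carrier H)"
    and zigzag_free: "zigzag_free (G \<times>\<times> H)"
    and x: "x \<in> carrier G" "G.ord x = p" and y: "y \<in> carrier H" "H.ord y = q"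
    and p: "prime p" and q: "prime q" and pq: "p \<noteq> q"
begin

text \<open>The setting is symmetric in the two factors, so each result about one of them also holds
  for the other with \<open>x\<close>, \<open>y\<close> and the primes exchanged.\<close>

lemma swap: "zigzag_free_product H G y x q p"
  using finite_G finite_H zigzag_free_DirProd_commute[OF G.group_axioms H.group_axioms zigzag_free]
    x y p q pq by unfold_locales auto

lemma xp: "x [^]\<^bsub>G\<^esub> p = \<one>\<^bsub>G\<^esub>"
  using x by auto

lemma yq: "y [^]\<^bsub>H\<^esub> q = \<one>\<^bsub>H\<^esub>"
  using y by auto

lemma x_ne_one: "x \<noteq> \<one>\<^bsub>G\<^esub>"
  using x p by auto

lemma y_ne_one: "y \<noteq> \<one>\<^bsub>H\<^esub>"
  using y q by auto

text \<open>\<open>(1, y) < (x, y) > (x, 1) < z\<close> is the only zigzag pattern that the argument needs.\<close>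

lemma no_zigzag:
  assumes z: "z \<in> carrier (G \<times>\<times> H)" "is_power (G \<times>\<times> H) (x, \<one>\<^bsub>H\<^esub>) z"
    and nc: "\<not> comparable (G \<times>\<times> H) (\<one>\<^bsub>G\<^esub>, y) z"
  shows "comparable (G \<times>\<times> H) (x, y) z"
proof (rule ccontr)
  assume c: "\<not> comparable (G \<times>\<times> H) (x, y) z"
  have "\<not> comparable (G \<times>\<times> H) (\<one>\<^bsub>G\<^esub>, y) (x, \<one>\<^bsub>H\<^esub>)"
    using x_ne_one y_ne_one by (simp add: comparable_def is_power_DirProd)
  then have "zigzag (G \<times>\<times> H) (\<one>\<^bsub>G\<^esub>, y) (x, y) (x, \<one>\<^bsub>H\<^esub>) z"
    unfolding zigzag_def
    using c nc z x(1) y(1) primes_coprime[OF p q pq]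
      is_power_DirProd_components[OF G.group_axioms H.group_axioms x(1) y(1) xp yq] by simp
  with zigzag_free show False unfolding zigzag_free_def by blast
qed

text \<open>Applied to \<open>(z, 1)\<close>, which is incomparable with \<open>(1, y)\<close>, the
  zigzag condition makes it comparable with \<open>(x, y)\<close>; as \<open>y\<close> is
  nontrivial, it must be the lower of the two.\<close>

lemma power_of_x_if_root_of_x:
  assumes z: "z \<in> carrier G" "is_power G x z"
  shows "is_power G z x"
proof -
  have "is_power (G \<times>\<times> H) (x, \<one>\<^bsub>H\<^esub>) (z, \<one>\<^bsub>H\<^esub>)"
    using z by (auto simp: is_power_DirProd is_power_def[of G] is_power_def[of H])
  moreover have "z \<noteq> \<one>\<^bsub>G\<^esub>" using z x_ne_one by (auto simp: is_power_def)
  then have "\<not> comparable (G \<times>\<times> H) (\<one>\<^bsub>G\<^esub>, y) (z, \<one>\<^bsub>H\<^esub>)"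
    using y_ne_one by (simp add: comparable_def is_power_DirProd)
  ultimately have "comparable (G \<times>\<times> H) (x, y) (z, \<one>\<^bsub>H\<^esub>)" using no_zigzag z by simp
  then show ?thesis using y_ne_one by (auto simp: comparable_def is_power_DirProd is_power_def[of G] is_power_def[of H])
qed

text \<open>The zigzag condition is applied to \<open>(x, y')\<close>, which lies above
  \<open>(x, 1)\<close> because \<open>r\<close> and \<open>p\<close> are coprime. The case
  \<open>r = q\<close> is included, so a second subgroup of order \<open>q\<close> is excluded as
  well.\<close>

lemma power_of_y_if_prime_order:
  assumes y': "y' \<in> carrier H" "H.ord y' = r" "prime r" "r \<noteq> p"
  shows "is_power H y' y"
proof (rule ccontr)
  assume n: "\<not> is_power H y' y"
  then have n': "\<not> is_power H y y'"
    using H.is_power_prime_sym[of y' y] y' y_ne_one by blast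
  have "y' [^]\<^bsub>H\<^esub> r = \<one>\<^bsub>H\<^esub>" using y' by auto
  moreover have "coprime p r" using p y' primes_coprime by blast
  ultimately have "is_power (G \<times>\<times> H) (x, \<one>\<^bsub>H\<^esub>) (x, y')"
    using is_power_DirProd_components[OF G.group_axioms H.group_axioms x(1) y'(1) xp] by blast
  moreover have "\<not> comparable (G \<times>\<times> H) (\<one>\<^bsub>G\<^esub>, y) (x, y')"
    using x_ne_one n' by (auto simp: comparable_def is_power_DirProd is_power_def[of G] is_power_def[of H])
  ultimately have "comparable (G \<times>\<times> H) (x, y) (x, y')" using no_zigzag x(1) y'(1) by simp
  then show False using n n' by (auto simp: comparable_def is_power_DirProd is_power_def[of G] is_power_def[of H])
qed

end

lemma prime_power_if_only_prime_divisor: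
  fixes n q :: nat
  assumes "n > 0" "prime q" "\<And>r. prime r \<Longrightarrow> r dvd n \<Longrightarrow> r = q"
  shows "\<exists>e. n = q ^ e"
proof -
  have "n \<noteq> 0" "\<not> is_unit q" using assms(1,2) by auto
  then obtain m where m: "n = q ^ multiplicity q n * m" "\<not> q dvd m"
    by (rule multiplicity_decompose')
  have "m = 1"
  proof (rule ccontr)
    assume "m \<noteq> 1"
    then obtain r where "prime r" "r dvd m" using prime_factor_nat by blast
    with m assms(3)[of r] show False by (metis dvd_mult)
  qed
  with m show ?thesis by auto
qed

context zigzag_free_product
begin

text \<open>If a prime \<open>r\<close> other than \<open>q\<close> divides the order of
  \<open>g\<close>, some power of \<open>g\<close> has order \<open>r\<close>. The mirrored form of
  \<open>power_of_y_if_prime_order\<close> places it among the powers of \<open>x\<close>, so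
  \<open>g\<close> is a root of \<open>x\<close> and thus itself a power of
  \<open>x\<close>.\<close>

lemma dichotomy:
  assumes g: "g \<in> carrier G"
  shows "is_power G g x \<or> (\<exists>e. G.ord g = q ^ e)"
proof (rule ccontr)
  assume n: "\<not> (is_power G g x \<or> (\<exists>e. G.ord g = q ^ e))"
  interpret S: zigzag_free_product H G y x q p by (rule swap)
  have o: "G.ord g > 0" using G.ord_ge_1[OF finite_G g] by simp
  then obtain r where r: "prime r" "r dvd G.ord g" "r \<noteq> q"
    using prime_power_if_only_prime_divisor[OF _ q, of "G.ord g"] n by blast
  then obtain c where c: "G.ord g = r * c" by blast
  define g' where "g' = g [^]\<^bsub>G\<^esub> c"
  have g'c: "g' \<in> carrier G" using g by (simp add: g'_def)
  have "c > 0" using c o by simp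
  then have og': "G.ord g' = r" unfolding g'_def using G.ord_pow[OF g, of c] c by simp
  have "is_power G g' x" using S.power_of_y_if_prime_order[OF g'c og' r(1,3)] .
  moreover have "g' \<noteq> \<one>\<^bsub>G\<^esub>" using og' r by auto
  ultimately have "is_power G x g'" using G.is_power_prime_sym x p by blast
  then have "is_power G x g" using G.is_power_trans[OF _ _ g] G.is_power_pow g'_def by metis
  then have "is_power G g x" by (rule power_of_x_if_root_of_x[OF g])
  with n show False by blast
qed

end

lemma (in group) ex_power_of_prime_order:
  assumes "g \<in> carrier G" "g \<noteq> \<one>" "ord g = q ^ e" "prime q"
  shows "\<exists>s \<in> carrier G. ord s = q"
proof -
  have "e \<noteq> 0" using assms ord_eq_1 by (metis power_0)
  then obtain e' where e: "e = Suc e'" by (cases e) auto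
  have "q > 0" using assms(4) prime_gt_0_nat by blast
  then have "ord (g [^] (q ^ e')) = q" using ord_pow[OF assms(1), of "q ^ e'"] assms(3) e by simp
  then show ?thesis using assms(1) by blast
qed

lemma (in group) right_factor_is_power:
  assumes "z \<in> carrier G" "s \<in> carrier G" "is_power G (z \<otimes> s) z" "z [^] (n::nat) = \<one>" "n > 0"
  shows "is_power G s z"
proof -
  have "is_power G (inv z \<otimes> (z \<otimes> s)) z" using is_power_mult is_power_inv assms by blast
  then show ?thesis using assms by (simp add: m_assoc[symmetric])
qed

lemma (in group) left_factor_is_power:
  assumes "z \<in> carrier G" "s \<in> carrier G" "is_power G (s \<otimes> z) z" "z [^] (n::nat) = \<one>" "n > 0"
  shows "is_power G s z"
proof -
  have "is_power G ((s \<otimes> z) \<otimes> inv z) z" using is_power_mult is_power_inv assms by blast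
  then show ?thesis using assms by (simp add: m_assoc)
qed

lemma (in group) not_is_power_distinct_prime_ord:
  assumes "u \<in> carrier G" "v \<in> carrier G" "prime (ord u)" "prime (ord v)" "ord u \<noteq> ord v"
  shows "\<not> is_power G u v"
proof
  assume "is_power G u v"
  then obtain n where "u = v [^] (n::nat)" by (auto simp: is_power_def)
  then have "u [^] ord v = \<one>" using pow_pow_eq_one assms by simp
  then have "ord u dvd ord v" using assms pow_eq_id by blast
  then show False using assms primes_dvd_imp_eq by blast
qed

context zigzag_free_product
begin

text \<open>If both factors were larger, \<open>G\<close> would contain some \<open>s\<close> of
  order \<open>q\<close> and \<open>H\<close> some \<open>t\<close> of order \<open>p\<close>. The
  pair \<open>s\<close>, \<open>t\<close> is again an instance of the locale with the primes
  exchanged, so \<open>G\<close> satisfies a second dichotomy that clashes with the first.\<close>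

lemma one_factor_generated:
  "(\<forall>g \<in> carrier G. is_power G g x) \<or> (\<forall>h \<in> carrier H. is_power H h y)"
proof (rule ccontr)
  interpret S: zigzag_free_product H G y x q p by (rule swap)
  assume "\<not> ?thesis"
  then obtain g h where g: "g \<in> carrier G" "\<not> is_power G g x" and h: "h \<in> carrier H" "\<not> is_power H h y"
    by blast
  have "g \<noteq> \<one>\<^bsub>G\<^esub>" "h \<noteq> \<one>\<^bsub>H\<^esub>" using g h G.is_power_one H.is_power_one by auto
  then obtain s t where s: "s \<in> carrier G" "G.ord s = q" and t: "t \<in> carrier H" "H.ord t = p"
    using dichotomy[OF g(1)] S.dichotomy[OF h(1)] g h p q
      G.ex_power_of_prime_order[OF g(1)] H.ex_power_of_prime_order[OF h(1)] by metis
  interpret T: zigzag_free_product G H s t q p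
    using s t p q pq finite_G finite_H zigzag_free by unfold_locales auto
  \<comment> \<open>Now \<open>G\<close> would be the union of the proper subgroups \<open>\<langle>x\<rangle>\<close> and \<open>\<langle>s\<rangle>\<close>; \<open>x s\<close> lies in neither.\<close>
  have xs: "x \<otimes>\<^bsub>G\<^esub> s \<in> carrier G" using x s by simp
  have p0: "p > 0" "q > 0" using p q prime_gt_0_nat by blast+
  have "\<not> is_power G (x \<otimes>\<^bsub>G\<^esub> s) x"
    using G.right_factor_is_power[OF x(1) s(1) _ xp p0(1)] G.not_is_power_distinct_prime_ord[of s x]
      s x p q pq by auto
  moreover have "\<not> is_power G (x \<otimes>\<^bsub>G\<^esub> s) s"
    using G.left_factor_is_power[OF s(1) x(1) _ T.xp p0(2)] G.not_is_power_distinct_prime_ord[of x s]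
      s x p q pq by auto
  ultimately obtain e f where ef: "G.ord (x \<otimes>\<^bsub>G\<^esub> s) = q ^ e" "G.ord (x \<otimes>\<^bsub>G\<^esub> s) = p ^ f"
    using dichotomy[OF xs] T.dichotomy[OF xs] by blast
  have "coprime (q ^ e) (p ^ f)" using primes_coprime[OF q p] pq by simp
  then have "x \<otimes>\<^bsub>G\<^esub> s = \<one>\<^bsub>G\<^esub>"
    using G.eq_one_if_coprime_pow[OF xs] G.pow_ord_eq_1[OF xs] ef by metis
  then have "is_power G (x \<otimes>\<^bsub>G\<^esub> s) x" using G.is_power_one by simp
  with \<open>\<not> is_power G (x \<otimes>\<^bsub>G\<^esub> s) x\<close> show False by blast
qed

end

section \<open>Structure of a group with a self-centralising subgroup of prime order\<close>

lemma prime_roots_of_unity_powers: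
  fixes p a c n :: nat
  assumes p: "prime p" and n: "Pocklington.ord p a = n" "n > 0" and c: "[c ^ n = 1] (mod p)"
  shows "\<exists>j. [c = a ^ j] (mod p)"
proof -
  define S where "S = {y \<in> {..<p}. [y ^ n = 1] (mod p)}"
  have p0: "p > 0" using p prime_gt_0_nat by blast
  \<comment> \<open>A counting argument: there are at most \<open>n\<close> roots of unity of
    exponent \<open>n\<close> modulo \<open>p\<close>, and the powers of \<open>a\<close> already
    supply \<open>n\<close> distinct ones.\<close>
  have "card S \<le> n" unfolding S_def by (rule roots_mod_prime_bound[OF p n(2)])
  have cop: "coprime p a" using n by (metis ord_eq_0 less_numeral_extra(3))
  let ?T = "(\<lambda>j. a ^ j mod p) ` {..<n}"
  have "inj_on (\<lambda>j. a ^ j mod p) {..<n}"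
  proof (rule inj_onI)
    fix i j assume ij: "i \<in> {..<n}" "j \<in> {..<n}" "a ^ i mod p = a ^ j mod p"
    then have "[i = j] (mod n)" using order_divides_expdiff[OF cop, of i j] n(1) by (simp add: cong_def)
    with ij show "i = j" using cong_less_modulus_unique_nat by simp
  qed
  then have "card ?T = n" by (simp add: card_image)
  moreover have "?T \<subseteq> S"
  proof
    fix z assume "z \<in> ?T"
    then obtain j where j: "z = a ^ j mod p" by blast
    have "[(a ^ j) ^ n = 1] (mod p)"
      using ord_divides[of a "j * n" p] n(1) by (simp add: power_mult)
    then show "z \<in> S" using p0 by (simp add: S_def j cong_def power_mod)
  qed
  moreover have "finite S" by (simp add: S_def)
  ultimately have "?T = S" using \<open>card S \<le> n\<close> by (metis card_seteq)
  moreover have "c mod p \<in> S" using c p0 by (simp add: S_def cong_def power_mod)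
  ultimately obtain j where "c mod p = a ^ j mod p" by blast
  then show ?thesis by (auto simp: cong_def)
qed

lemma (in group) conj_pow:
  assumes "x \<in> carrier G" "g \<in> carrier G"
  shows "(inv g \<otimes> x \<otimes> g) [^] (n::nat) = inv g \<otimes> x [^] n \<otimes> g"
proof (induction n)
  case (Suc n)
  have "g \<otimes> (inv g \<otimes> (x \<otimes> g)) = x \<otimes> g" using assms by (simp flip: m_assoc)
  then show ?case unfolding nat_pow_Suc Suc using assms by (simp add: m_assoc)
qed (use assms in simp)

lemma (in group) frobenius_structure:
  fixes p q :: nat
  assumes fin: "finite (carrier G)" and x: "x \<in> carrier G" "ord x = p"
    and p: "prime p" and q: "prime q" and pq: "p \<noteq> q"
    and dich: "\<And>g. g \<in> carrier G \<Longrightarrow> is_power G g x \<or> (\<exists>e. ord g = q ^ e)"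
    and nt: "\<exists>g \<in> carrier G. \<not> is_power G g x"
  shows "\<exists>m k. m \<ge> 1 \<and> q ^ m dvd p - 1 \<and> Pocklington.ord (int p) (int k) = q ^ m \<and>
    \<not> comm_group G \<and> metacyclic_pres p (q ^ m) (int k) \<cong> G"
proof -
  have xp: "x [^] p = \<one>" using x by auto
  have p0: "p > 0" "q > 0" using p q prime_gt_0_nat by blast+
  have x1: "x \<noteq> \<one>" using x p by auto
  have cop: "coprime p (q ^ e)" for e using primes_coprime[OF p q pq] by simp
  have xq: "x [^] (q ^ e) \<noteq> \<one>" for e
    using eq_one_if_coprime_pow[OF x(1) xp _ cop] x1 by blast
  have qpow: "g [^] (q ^ e) = \<one>" if "ord g = q ^ e" "g \<in> carrier G" for g e
    using that pow_ord_eq_1 by metis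
  have "\<exists>k::nat. inv g \<otimes> x \<otimes> g = x [^] k" if g: "g \<in> carrier G" for g
  proof -
    let ?c = "inv g \<otimes> x \<otimes> g"
    have c: "?c \<in> carrier G" using g x by simp
    \<comment> \<open>A conjugate of \<open>x\<close> with \<open>q\<close>-power order would give
      \<open>x\<close> itself \<open>q\<close>-power order, so the conjugate falls into the other
      case of the dichotomy.\<close>
    have "ord ?c \<noteq> q ^ e" for e
    proof
      assume "ord ?c = q ^ e"
      then have "inv g \<otimes> x [^] (q ^ e) \<otimes> g = \<one>" using qpow c conj_pow[OF x(1) g] by metis
      then have "x [^] (q ^ e) = \<one>"
        using g x by (metis inv_closed inv_inv inv_solve_left l_inv m_closed nat_pow_closed r_inv
            inv_unique' m_assoc r_one)
      with xq show False by blast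
    qed
    then show ?thesis using dich[OF c] by (auto simp: is_power_def)
  qed
  then obtain K :: "'a \<Rightarrow> nat" where K: "\<And>g. g \<in> carrier G \<Longrightarrow> inv g \<otimes> x \<otimes> g = x [^] K g"
    by metis
  have swap: "x \<otimes> g [^] j = g [^] j \<otimes> x [^] (K g ^ j)" if g: "g \<in> carrier G" for g and j :: nat
    using metacyclic_swap[OF x(1) g K[OF g], of 1 j] x by simp
  \<comment> \<open>Thus the order of \<open>K g\<close> modulo \<open>p\<close> is the order of the
    automorphism that \<open>g\<close> induces on the powers of \<open>x\<close>.\<close>
  have commute_iff: "x \<otimes> g [^] j = g [^] j \<otimes> x \<longleftrightarrow> Pocklington.ord p (K g) dvd j"
    if g: "g \<in> carrier G" for g and j :: nat
  proof -
    have "x \<otimes> g [^] j = g [^] j \<otimes> x \<longleftrightarrow> x [^] (K g ^ j) = x [^] (1::nat)"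
      unfolding swap[OF g] using g x by simp
    also have "\<dots> \<longleftrightarrow> [K g ^ j = 1] (mod p)" using nat_pow_eq_iff_cong[OF x(1)] x(2) by blast
    finally show ?thesis by (simp only: ord_divides)
  qed
  have power_commutes: "x \<otimes> g = g \<otimes> x" if "is_power G g x" for g
    using that x by (auto simp: is_power_def) (metis nat_pow_Suc nat_pow_Suc2)
  \<comment> \<open>Were \<open>c\<close> not a power of \<open>x\<close>, both \<open>c\<close> and
    their product with \<open>x\<close> would have \<open>q\<close>-power order; as they commute, so
    would \<open>x\<close>.\<close>
  have centralizer: "is_power G c x" if c: "c \<in> carrier G" "x \<otimes> c = c \<otimes> x" for c
  proof (rule ccontr)
    assume nc: "\<not> is_power G c x"
    with dich[OF c(1)] obtain e where e: "ord c = q ^ e" by blast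
    have xc: "x \<otimes> c \<in> carrier G" using x c by simp
    have "\<not> is_power G (x \<otimes> c) x" using right_factor_is_power[OF x(1) c(1) _ xp p0(1)] nc by blast
    with dich[OF xc] obtain f where f: "ord (x \<otimes> c) = q ^ f" by blast
    have "(x \<otimes> c) [^] (q ^ (e + f)) = \<one>"
      using pow_eq_one_if_dvd[OF qpow[OF f xc] _ xc] by (simp add: le_imp_power_dvd)
    moreover have "c [^] (q ^ (e + f)) = \<one>"
      using pow_eq_one_if_dvd[OF qpow[OF e c(1)] _ c(1)] by (simp add: le_imp_power_dvd)
    ultimately have "x [^] (q ^ (e + f)) = \<one>" using pow_mult_distrib[OF c(2) x(1) c(1)] x by simp
    with xq show False by blast
  qed
  have ordK: "\<exists>f. Pocklington.ord p (K g) = q ^ f" if g: "g \<in> carrier G" for g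
  proof (cases "is_power G g x")
    case True
    then have "Pocklington.ord p (K g) dvd 1" using commute_iff[OF g, of 1] power_commutes g by simp
    then have "Pocklington.ord p (K g) = q ^ 0" by simp
    then show ?thesis by blast
  next
    case False
    then obtain e where "ord g = q ^ e" using dich[OF g] by blast
    then have "Pocklington.ord p (K g) dvd q ^ e"
      using commute_iff[OF g, of "q ^ e"] qpow g x by simp
    then show ?thesis using q divides_primepow_nat by blast
  qed
  \<comment> \<open>Conjugation embeds \<open>G / \<langle>x\<rangle>\<close> into the units mod \<open>p\<close>; an element \<open>b\<close> whose image has
    maximal order generates that image, since all orders there are powers of \<open>q\<close>.\<close>
  let ?S = "(\<lambda>g. Pocklington.ord p (K g)) ` carrier G"
  have S: "finite ?S" "?S \<noteq> {}" using fin by auto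
  obtain b where b: "b \<in> carrier G" "Pocklington.ord p (K b) = Max ?S"
    using Max_in[OF S] by auto
  obtain m where m: "Pocklington.ord p (K b) = q ^ m" using ordK[OF b(1)] by blast
  have q1: "q > 1" using q prime_gt_1_nat by blast
  have ord_dvd: "Pocklington.ord p (K g) dvd q ^ m" if g: "g \<in> carrier G" for g
  proof -
    obtain f where f: "Pocklington.ord p (K g) = q ^ f" using ordK[OF g] by blast
    have "Pocklington.ord p (K g) \<le> Max ?S" using S g by (intro Max_ge) auto
    then have "q ^ f \<le> q ^ m" using f m b(2) by simp
    then have "f \<le> m" using q1 by simp
    then show ?thesis using f le_imp_power_dvd by metis
  qed
  have gen: "\<exists>(j::nat) (i::nat). g = b [^] j \<otimes> x [^] i" if g: "g \<in> carrier G" for g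
  proof -
    have "[K g ^ (q ^ m) = 1] (mod p)" using ord_dvd[OF g] ord_divides by blast
    then obtain j where j: "[K g = K b ^ j] (mod p)"
      using prime_roots_of_unity_powers[OF p m] p0 by auto
    then have e: "x [^] K g = x [^] (K b ^ j)" using nat_pow_eq_iff_cong[OF x(1)] x(2) by blast
    have bj: "b [^] j \<in> carrier G" using b by simp
    have "b [^] j \<otimes> x [^] K g = x \<otimes> b [^] j" using swap[OF b(1)] e by simp
    then have "x [^] K g = inv (b [^] j) \<otimes> (x \<otimes> b [^] j)"
      using x bj by (metis inv_solve_left m_closed nat_pow_closed)
    then have 1: "x [^] K g \<otimes> inv (b [^] j) = inv (b [^] j) \<otimes> x"
      using x bj by (simp add: m_assoc)
    have 2: "x \<otimes> g = g \<otimes> x [^] K g" using swap[OF g, of 1] g by simp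
    \<comment> \<open>\<open>g\<close> and \<open>b [^] j\<close> conjugate \<open>x\<close> in the
      same way, so this quotient centralises \<open>x\<close> and is therefore a power of
      \<open>x\<close>.\<close>
    let ?c = "g \<otimes> inv (b [^] j)"
    have "x \<otimes> ?c = (x \<otimes> g) \<otimes> inv (b [^] j)" using x g bj by (simp add: m_assoc)
    also have "\<dots> = g \<otimes> (x [^] K g \<otimes> inv (b [^] j))" unfolding 2 using x g bj by (simp add: m_assoc)
    also have "\<dots> = ?c \<otimes> x" unfolding 1 using x g bj by (simp add: m_assoc)
    finally have "is_power G ?c x" using centralizer g bj by simp
    then obtain i where "?c = x [^] (i::nat)" by (auto simp: is_power_def)
    then have "g = x [^] i \<otimes> b [^] j" using x g bj by (metis inv_solve_right nat_pow_closed inv_closed inv_inv)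
    then show ?thesis using metacyclic_swap[OF x(1) b(1) K[OF b(1)]] by metis
  qed
  have nb: "\<not> is_power G b x"
  proof
    assume "is_power G b x"
    then obtain l where l: "b = x [^] (l::nat)" by (auto simp: is_power_def)
    have "is_power G g x" if g: "g \<in> carrier G" for g
    proof -
      obtain j i where "g = b [^] (j::nat) \<otimes> x [^] (i::nat)" using gen[OF g] by blast
      then have "g = x [^] (l * j + i)" using x l by (simp add: nat_pow_pow nat_pow_mult)
      then show ?thesis by (simp only: is_power_pow)
    qed
    with nt show False by blast
  qed
  have not_comm: "x \<otimes> b \<noteq> b \<otimes> x" using centralizer b nb by blast
  then have m1: "m \<noteq> 0" using commute_iff[OF b(1), of 1] m b by auto
  \<comment> \<open>This power of \<open>b\<close> centralises \<open>x\<close>, hence is a power of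
    \<open>x\<close> and killed by \<open>p\<close>; but \<open>b\<close> has \<open>q\<close>-power
    order.\<close>
  have bn: "b [^] (q ^ m) = \<one>"
  proof -
    have "x \<otimes> b [^] (q ^ m) = b [^] (q ^ m) \<otimes> x" using commute_iff[OF b(1)] m by simp
    then have "is_power G (b [^] (q ^ m)) x" using centralizer b by simp
    then have "(b [^] (q ^ m)) [^] p = \<one>" using pow_pow_eq_one[OF xp x(1)] by (auto simp: is_power_def)
    moreover obtain e where "ord b = q ^ e" using dich[OF b(1)] nb by blast
    then have "(b [^] (q ^ m)) [^] (q ^ e) = \<one>" using pow_pow_eq_one[OF qpow] b by blast
    ultimately show ?thesis using eq_one_if_coprime_pow[OF _ _ _ cop] b by simp
  qed
  have "metacyclic_pres p (q ^ m) (int (K b)) \<cong> G"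
  proof (rule metacyclic_pres_iso[OF x(1) b(1) x(2) p0(1) _ bn K[OF b(1)] _ gen])
    show "q ^ m > 0" using p0 by simp
    show "q ^ m dvd j" if "is_power G (b [^] j) x" for j :: nat
      using power_commutes[OF that] commute_iff[OF b(1)] m by simp
  qed
  moreover have "\<not> comm_group G" using not_comm x(1) b(1) comm_groupE(4) by metis
  moreover have "Pocklington.ord (int p) (int (K b)) = q ^ m"
    using ord_int_mod[OF p0(1), of "int (K b)"] m by (simp add: nat_mod_distrib flip: of_nat_mod)
  \<comment> \<open>A positive order signals that \<open>K b\<close> is a unit modulo
    \<open>p\<close>, and the order of a unit divides \<open>totient p\<close>, which is
    \<open>p - 1\<close>.\<close>
  moreover have "Pocklington.ord p (K b) > 0" unfolding m using p0 by simp
  then have "coprime p (K b)" by (simp only: ord_gt_0_iff)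
  then have "q ^ m dvd p - 1" using order_divides_totient[of p "K b"] m p by (simp add: totient_prime)
  ultimately show ?thesis using m1 by (intro exI[of _ m] exI[of _ "K b"]) simp
qed

section \<open>Cyclic factors, Cauchy's theorem and the final case distinction\<close>

lemma (in group) cyclic_if_all_powers:
  assumes "finite (carrier G)" "y \<in> carrier G" "\<forall>h \<in> carrier G. is_power G h y"
  shows "cyclic_group G" "order G = ord y"
proof -
  have c: "carrier G = {y [^] k | k. k \<in> (UNIV :: nat set)}" using assms(2,3) by (auto simp: is_power_def)
  then show "order G = ord y"
    using generate_pow_on_finite_carrier[OF assms(1,2)] generate_pow_card[OF assms(2)]
    by (simp add: order_def)
  have "carrier G = range (\<lambda>n::int. y [^] n)"
  proof
    show "carrier G \<subseteq> range (\<lambda>n::int. y [^] n)"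
      using assms(3) by (auto simp: is_power_def simp flip: int_pow_int)
  qed (use assms(2) in auto)
  then show "cyclic_group G" unfolding cyclic_group using assms(2) by blast
qed

text \<open>Cauchy's theorem, from Sylow's theorem with exponent 1; the cofactor \<open>m\<close>
  may still be divisible by \<open>p\<close>.\<close>

lemma (in group) ex_ord_eq_prime:
  assumes fin: "finite (carrier G)" and p: "prime p" "p dvd order G"
  shows "\<exists>x \<in> carrier G. ord x = p"
proof -
  obtain m where m: "order G = p ^ 1 * m" using p(2) by auto
  obtain P where P: "subgroup P G" "card P = p ^ 1"
    using sylow_thm[OF p(1) group_axioms m fin] by blast
  interpret P: subgroup P G by fact
  interpret GP: group "G\<lparr>carrier := P\<rparr>" by (rule P.subgroup_is_group[OF group_axioms])
  have "\<not> P \<subseteq> {\<one>}" using P(2) p(1) card_mono[of "{\<one>}" P] prime_gt_1_nat[OF p(1)] by auto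
  then obtain x where x: "x \<in> P" "x \<noteq> \<one>" by blast
  then have xG: "x \<in> carrier G" using P.subset by blast
  have "x [^]\<^bsub>G\<lparr>carrier := P\<rparr>\<^esub> p = \<one>"
    using GP.pow_order_eq_1[of x] x P(2) by (simp add: order_def)
  then have "x [^] p = \<one>" using nat_pow_consistent by metis
  then have "ord x dvd p" using xG pow_eq_id by blast
  moreover have "ord x \<noteq> 1" using xG x ord_eq_1 by metis
  ultimately have "ord x = p" using p(1) prime_nat_iff by blast
  with xG show ?thesis by blast
qed

lemma (in zigzag_free_product) cyclic_factor_cases:
  assumes H: "\<forall>h \<in> carrier H. is_power H h y"
  shows "cyclic_group H \<and> order H = q \<and>
    (cyclic_group G \<and> order G = p \<or>
     (\<exists>m k. m \<ge> 1 \<and> q ^ m dvd p - 1 \<and> Pocklington.ord (int p) (int k) = q ^ m \<and>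
        \<not> comm_group (metacyclic_pres p (q ^ m) (int k)) \<and> G \<cong> metacyclic_pres p (q ^ m) (int k)))"
proof (cases "\<forall>g \<in> carrier G. is_power G g x")
  case True
  then show ?thesis
    using G.cyclic_if_all_powers[OF finite_G x(1)] H.cyclic_if_all_powers[OF finite_H y(1) H] x y
    by simp
next
  case False
  then have nt: "\<exists>g \<in> carrier G. \<not> is_power G g x" by blast
  obtain m k where mk: "m \<ge> 1" "q ^ m dvd p - 1" "Pocklington.ord (int p) (int k) = q ^ m"
    "\<not> comm_group G" and iso: "metacyclic_pres p (q ^ m) (int k) \<cong> G"
    using G.frobenius_structure[OF finite_G x p q pq dichotomy nt] by blast
  let ?P = "metacyclic_pres p (q ^ m) (int k)"
  have P: "group ?P" by (simp add: metacyclic_pres_eq group_presented_group)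
  have "\<not> comm_group ?P" using comm_group.iso_imp_comm_group[OF _ iso G.is_monoid] mk(4) by blast
  moreover have "G \<cong> ?P" using group.iso_sym[OF P iso] .
  ultimately show ?thesis using mk(1-3) H.cyclic_if_all_powers[OF finite_H y(1) H] y by blast
qed

text \<open>If no such pair existed, every prime divisor of \<open>a\<close> would equal every prime
  divisor of \<open>b\<close>, so both numbers would be powers of one prime.\<close>

lemma ex_distinct_prime_divisors:
  fixes a b :: nat
  assumes "a > 1" "b > 1" and npow: "\<not> (\<exists>p. prime p \<and> (\<exists>i. a = p ^ i) \<and> (\<exists>j. b = p ^ j))"
  shows "\<exists>p q. prime p \<and> prime q \<and> p \<noteq> q \<and> p dvd a \<and> q dvd b"
proof (rule ccontr)
  assume n: "\<not> ?thesis"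
  obtain p where p: "prime p" "p dvd a" using assms(1) prime_factor_nat[of a] by auto
  obtain q where q: "prime q" "q dvd b" using assms(2) prime_factor_nat[of b] by auto
  have "\<exists>j. b = p ^ j" using n p assms(2) by (intro prime_power_if_only_prime_divisor) auto
  moreover have "\<exists>i. a = p ^ i"
    using n p q assms(1) by (intro prime_power_if_only_prime_divisor) auto
  ultimately show False using npow p by blast
qed

lemma (in group) order_gt_one:
  assumes "finite (carrier G)" "\<not> trivial_group G"
  shows "order G > 1"
proof -
  have "carrier G \<noteq> {\<one>}" using assms(2) trivial_group by blast
  then have "{\<one>} \<subset> carrier G" by blast
  then have "card {\<one>} < card (carrier G)" by (rule psubset_card_mono[OF assms(1)])
  then show ?thesis by (simp add: order_def)
qed

theorem theorem2p1:
  fixes G :: "('a, 'm) monoid_scheme" and H :: "('b, 'n) monoid_scheme"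
  assumes "group G" and "finite (carrier G)" and "\<not> trivial_group G"
    and "group H" and "finite (carrier H)" and "\<not> trivial_group H"
  shows "cograph (power_graph (G \<times>\<times> H)) \<longleftrightarrow>
    (\<exists>p::nat. prime p \<and> (\<exists>i. order G = p ^ i) \<and> (\<exists>j. order H = p ^ j))
    \<or> (\<exists>p q::nat. prime p \<and> prime q \<and> p \<noteq> q \<and>
         cyclic_group G \<and> order G = p \<and> cyclic_group H \<and> order H = q)
    \<or> (\<exists>(p::nat) (q::nat) (m::nat) (k::int). prime p \<and> prime q \<and> m \<ge> 1 \<and> q ^ m dvd (p - 1) \<and>
         ord (int p) k = q ^ m \<and> \<not> comm_group (metacyclic_pres p (q ^ m) k) \<and>
         (cyclic_group G \<and> order G = q \<and> H \<cong> metacyclic_pres p (q ^ m) k \<or>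
          cyclic_group H \<and> order H = q \<and> G \<cong> metacyclic_pres p (q ^ m) k))"
    (is "?L \<longleftrightarrow> ?a \<or> ?b \<or> ?c")
proof -
  interpret G: group G by fact
  interpret H: group H by fact
  have GH: "group (G \<times>\<times> H)" by (intro DirProd_group assms)
  have iff: "?L \<longleftrightarrow> zigzag_free (G \<times>\<times> H)" by (rule cograph_power_graph_iff[OF GH])
  show ?thesis
  proof
    assume ?L
    then have zf: "zigzag_free (G \<times>\<times> H)" using iff by blast
    show "?a \<or> ?b \<or> ?c"
    proof (cases ?a)
      case False
      obtain p q where pq: "prime p" "prime q" "p \<noteq> q" "p dvd order G" "q dvd order H"
        using ex_distinct_prime_divisors[OF G.order_gt_one[OF assms(2,3)] H.order_gt_one[OF assms(5,6)] False]
        by blast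
      obtain x where x: "x \<in> carrier G" "G.ord x = p" using G.ex_ord_eq_prime[OF assms(2) pq(1,4)] by blast
      obtain y where y: "y \<in> carrier H" "H.ord y = q" using H.ex_ord_eq_prime[OF assms(5) pq(2,5)] by blast
      interpret Z: zigzag_free_product G H x y p q
        using assms zf x y pq by unfold_locales auto
      interpret S: zigzag_free_product H G y x q p by (rule Z.swap)
      from Z.one_factor_generated show ?thesis
      proof
        assume "\<forall>g \<in> carrier G. is_power G g x"
        then show ?thesis using S.cyclic_factor_cases pq(1-3) by blast
      next
        assume "\<forall>h \<in> carrier H. is_power H h y"
        then show ?thesis using Z.cyclic_factor_cases pq(1-3) by blast
      qed
    qed blast
  next
    assume "?a \<or> ?b \<or> ?c"
    then consider ?a | ?b | ?c by blast
    then have "zigzag_free (G \<times>\<times> H)"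
    proof cases
      case 1
      then obtain p i j where p: "prime p" "order G = p ^ i" "order H = p ^ j" by blast
      have "order (G \<times>\<times> H) = p ^ (i + j)"
        using p(2,3) by (simp add: order_def card_cartesian_product power_add)
      then show ?thesis using zigzag_free_if_prime_power_order[OF GH p(1)] by blast
    next
      case 2
      then obtain p q where pq: "prime p" "prime q" "p \<noteq> q" "order G = p" "order H = q" by blast
      \<comment> \<open>Case (b) is the instance of the common core in which every element of
        \<open>H\<close> is a power of \<open>A\<close>; the primes enter with their roles
        exchanged.\<close>
      have "\<not> carrier H \<subseteq> {\<one>\<^bsub>H\<^esub>}" using assms(6) H.trivial_group_subset by blast
      then obtain A where A: "A \<in> carrier H" "A \<noteq> \<one>\<^bsub>H\<^esub>" by blast
      have "A [^]\<^bsub>H\<^esub> q = \<one>\<^bsub>H\<^esub>" using H.pow_order_eq_1[OF A(1)] pq(5) by simp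
      moreover have "is_power H h A" if "h \<in> carrier H" for h
        using H.is_power_if_prime_order[OF _ A that] pq by simp
      ultimately show ?thesis
        using zigzag_free_prime_times_frobenius[OF assms(1,4) pq(2,1) _ pq(4) A(1)] pq(3) by blast
    next
      case 3
      then obtain p q m k where pq: "prime p" "prime q" "m \<ge> 1" "q ^ m dvd p - 1"
        and k: "Pocklington.ord (int p) k = q ^ m"
        and GH: "order G = q \<and> H \<cong> metacyclic_pres p (q ^ m) k \<or>
          order H = q \<and> G \<cong> metacyclic_pres p (q ^ m) k" by blast
      \<comment> \<open>Distinctness of the primes is not part of case (c); it follows from
        \<open>q\<close> dividing the positive number \<open>p - 1\<close>.\<close>
      have "q dvd p - 1" using pq(3,4) by (metis dvd_power dvd_trans less_eq_Suc_le One_nat_def)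
      then have "p \<noteq> q" using prime_gt_1_nat[OF pq(1)] by (auto dest: dvd_imp_le)
      from GH show ?thesis
      proof
        assume "order G = q \<and> H \<cong> metacyclic_pres p (q ^ m) k"
        then show ?thesis
          using zigzag_free_prime_times_metacyclic[OF assms(1,4) pq(1,2) \<open>p \<noteq> q\<close> _ k] by blast
      next
        assume "order H = q \<and> G \<cong> metacyclic_pres p (q ^ m) k"
        then have "zigzag_free (H \<times>\<times> G)"
          using zigzag_free_prime_times_metacyclic[OF assms(4,1) pq(1,2) \<open>p \<noteq> q\<close> _ k] by blast
        then show ?thesis by (rule zigzag_free_DirProd_commute[OF assms(4,1)])
      qed
    qed
    then show ?L using iff by blast
  qed
qed

end
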